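(* Let $g:\mathcal X\times\mathbb R\times\mathbb R^d\to\mathbb R^d$ be a score function and for each $a\in\mathcal A$ let $\theta_a^*\in\mathbb R^d$ satisfy $\mathbb E[g(X,Y(a);\theta_a^* )]=0$; put $\theta^*=(\theta_a^* )_{a\in\mathcal A}$. Assume (1) $A_t\perp\{Y_t(a')\}_{a'\in\mathcal A}\mid(\mathcal H_{t-1},X_t)$ for all $t$, and that, with constants $R_\theta,M_2$, for every $a\in\mathcal A$: (2) For all $\epsilon>0$, $\inf_{\|\theta-\theta_a^*\|_2>\epsilon}\|\mathbb E[g(X_t,Y_t(a);\theta)]\|_2>0$. (3) (i) $\|\mathbb E[g(X_t,Y_t(a);\theta_a^* )g(X_t,Y_t(a);\theta_a^* )^\top\mid X_t]\|_2\le M_2$ for a.e. $X_t$; (ii) $\|\theta_a^*\|_2<R_\theta$ and $\sup_{\|\theta\|_2\le R_\theta}\mathbb E[\|g(X_t,Y_t(a);\theta)\|_2^2]<\infty$; (iii) $\mathbb E[\|g(X_t,Y_t(a);\theta_a^* )\|_2^4]<\infty$. (4) (i) $g(x,y;\theta)$ is twice differentiable in $\theta$, and $\mathbb E[\nabla g(X_t,Y_t(a);\theta_a^* )]$ is nonsingular; (ii) there is a function $\phi$ (possibly depending on $a$) with $\sup_{\|\theta\|_2\le R_\theta}\|\nabla g(x,y;\theta)\|_2\le\phi(x,y)$ for all $x,y$ and $\mathbb E[\phi(X_t,Y_t(a))^2]<\infty$; (iii) there are $\epsilon_0>0$ and a function $\Phi$ (possibly depending on $a$) with $\sup_{\|\theta-\theta_a^*\|_2\le\epsilon_0,\,i\in[d]}\|\nabla^2g^{(i)}(x,y;\theta)\|_2\le\Phi(x,y)$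 and $\mathbb E[\Phi(X_t,Y_t(a))]<\infty$. (5) $\pi_t(a)\ge\pi_{\min}$ almost surely for some constant $\pi_{\min}\in(0,1)$. Suppose the behavior policy at each time $t$ is $$\pi_t(\cdot\mid X_t,\mathcal H_{t-1})=\pi(\cdot\mid X_t,\{\hat\theta_a^{(t-1)}\}_{a\in\mathcal A},\gamma_{t-1}),$$ where for each $a$ the estimators $\hat\theta_a^{(t)}$ (functions of the data up to time $t$, $\|\hat\theta_a^{(t)}\|_2\le R_\theta$) satisfy $\frac1t\sum_{\tau=1}^t\frac{1_{\{A_\tau=a\}}}{\pi_\tau(A_\tau)}g(X_\tau,Y_\tau;\hat\theta_a^{(t)})=o_p(1/\sqrt t)$, and $\{\gamma_t\}$ is a deterministic sequence in $\mathbb R^{d_\gamma}$ with $\lim_{t\to\infty}\gamma_t=\gamma^*\in\mathbb R^{d_\gamma}$. Assume that $\pi:\mathcal X\times\mathbb R^{Kd}\times\mathbb R^{d_\gamma}\to\Delta(\mathcal A)$ is continuous in its second and third arguments at $(\theta^*,\gamma^* )$ for almost every $x\in\mathcal X$ under the distribution of $X_t$. Then the behavior policy converges with limit policy $\bar\pi(a\mid x)=\pi(a\mid x,\theta^*,\gamma^* )$, i.e. $\pi_t(a\mid X_t,\mathcal H_{t-1})-\bar\pi(a\mid X_t)\xrightarrow{p}0$ as $t\to\infty$ for every $a\in\mathcal A$.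
   Context: Contextual bandit setting. Contexts $X_t\in\mathcal X\subseteq\mathbb R^{d_X}$, finite action set $\mathcal A=\{1,\dots,K\}$, potential outcomes $Y_t(a)\in\mathbb R$; the tuples $(X_t,\{Y_t(a)\}_{a\in\mathcal A})$, $t\ge1$, are i.i.d., with generic copy $(X,\{Y(a)\})$. At time $t$, given the history $\mathcal H_{t-1}=\{X_\tau,\pi_\tau,A_\tau,Y_\tau\}_{\tau<t}$ and $X_t$, the action $A_t$ is drawn from the behavior policy $\pi_t(\cdot\mid X_t,\mathcal H_{t-1})\in\Delta(\mathcal A)$ (probability distributions on $\mathcal A$), and the outcome $Y_t=Y_t(A_t)$ is observed. The tuple $(X_t,\{Y_t(a)\}_a)$ is independent of $\mathcal H_{t-1}$. We abbreviate $\pi_t(a)=\pi_t(a\mid X_t,\mathcal H_{t-1})$. $\nabla g$ denotes the Jacobian of $g$ in $\theta$, $\nabla^2 g^{(i)}$ the Hessian in $\theta$ of the $i$-th entry of $g$; $\|\cdot\|_2$ is the Euclidean norm of vectors and the spectral norm of matrices. *)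

theory Defs
  imports "HOL-Probability.Probability"
begin

section \<open>Convergence in probability\<close>

definition converges_in_prob ::
  "'w measure \<Rightarrow> (nat \<Rightarrow> 'w \<Rightarrow> 'b::real_normed_vector) \<Rightarrow> ('w \<Rightarrow> 'b) \<Rightarrow> bool" where
  "converges_in_prob M Z Z\<^sub>0 \<longleftrightarrow>
     (\<forall>\<epsilon>>0. (\<lambda>t. measure M {\<omega> \<in> space M. norm (Z t \<omega> - Z\<^sub>0 \<omega>) > \<epsilon>}) \<longlonglongrightarrow> 0)"

text \<open>\<open>Z\<^sub>t = o\<^sub>p(r\<^sub>t)\<close> for a real sequence \<open>r\<close>.\<close>

definition little_o_p ::
  "'w measure \<Rightarrow> (nat \<Rightarrow> 'w \<Rightarrow> 'b::real_normed_vector) \<Rightarrow> (nat \<Rightarrow> real) \<Rightarrow> bool" where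
  "little_o_p M Z r \<longleftrightarrow> converges_in_prob M (\<lambda>t \<omega>. Z t \<omega> /\<^sub>R r t) (\<lambda>_. 0)"


section \<open>Independence\<close>

definition iid_vars :: "'w measure \<Rightarrow> 'b measure \<Rightarrow> ('i \<Rightarrow> 'w \<Rightarrow> 'b) \<Rightarrow> 'i set \<Rightarrow> bool" where
  "iid_vars M N Z I \<longleftrightarrow>
     prob_space.indep_vars M (\<lambda>_. N) Z I \<and> (\<forall>i\<in>I. \<forall>j\<in>I. distr M N (Z i) = distr M N (Z j))"

text \<open>The library's \<open>indep_var\<close> forces both variables to have the same value type.\<close>

definition indep_rvs ::
  "'w measure \<Rightarrow> 'b measure \<Rightarrow> ('w \<Rightarrow> 'b) \<Rightarrow> 'c measure \<Rightarrow> ('w \<Rightarrow> 'c) \<Rightarrow> bool" where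
  "indep_rvs M N\<^sub>1 U N\<^sub>2 V \<longleftrightarrow>
     U \<in> measurable M N\<^sub>1 \<and> V \<in> measurable M N\<^sub>2 \<and>
     prob_space.indep_set M (sets (vimage_algebra (space M) U N\<^sub>1))
                            (sets (vimage_algebra (space M) V N\<^sub>2))"

text \<open>Conditional independence of \<open>U\<close> and \<open>V\<close> given the sub-\<open>\<sigma>\<close>-algebra \<open>F\<close>.\<close>

definition cond_indep_var ::
  "'w measure \<Rightarrow> 'w measure \<Rightarrow> 'b measure \<Rightarrow> ('w \<Rightarrow> 'b) \<Rightarrow> 'c measure \<Rightarrow> ('w \<Rightarrow> 'c) \<Rightarrow> bool" where
  "cond_indep_var M F N\<^sub>1 U N\<^sub>2 V \<longleftrightarrow>
     U \<in> measurable M N\<^sub>1 \<and> V \<in> measurable M N\<^sub>2 \<and>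
     (\<forall>B\<^sub>1\<in>sets N\<^sub>1. \<forall>B\<^sub>2\<in>sets N\<^sub>2. AE \<omega> in M.
        real_cond_exp M F (\<lambda>\<omega>. indicator B\<^sub>1 (U \<omega>) * indicator B\<^sub>2 (V \<omega>)) \<omega> =
        real_cond_exp M F (\<lambda>\<omega>. indicator B\<^sub>1 (U \<omega>)) \<omega> *
        real_cond_exp M F (\<lambda>\<omega>. indicator B\<^sub>2 (V \<omega>)) \<omega>)"


section \<open>Vectors and matrices\<close>

definition prob_simplex :: "(real^'k) set" where
  "prob_simplex = {p. (\<forall>a. 0 \<le> p $ a) \<and> (\<Sum>a\<in>UNIV. p $ a) = 1}"

definition spectral_norm :: "real^'n^'m \<Rightarrow> real" where
  "spectral_norm A = onorm (\<lambda>v. A *v v)"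

definition outer :: "real^'m \<Rightarrow> real^'n \<Rightarrow> real^'n^'m" where
  "outer u v = (\<chi> i j. u $ i * v $ j)"

definition matrix_cond_exp ::
  "'w measure \<Rightarrow> 'w measure \<Rightarrow> ('w \<Rightarrow> real^'n^'m) \<Rightarrow> 'w \<Rightarrow> real^'n^'m" where
  "matrix_cond_exp M F Z \<omega> = (\<chi> i j. real_cond_exp M F (\<lambda>\<omega>'. Z \<omega>' $ i $ j) \<omega>)"

definition grad :: "(real^'n \<Rightarrow> real) \<Rightarrow> real^'n \<Rightarrow> real^'n" where
  "grad f x = (\<chi> j. frechet_derivative f (at x) (axis j 1))"

definition hessian :: "(real^'n \<Rightarrow> real) \<Rightarrow> real^'n \<Rightarrow> real^'n^'n" where
  "hessian f x = jacobian (grad f) (at x)"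

definition twice_differentiable :: "(real^'n \<Rightarrow> real^'m) \<Rightarrow> bool" where
  "twice_differentiable f \<longleftrightarrow>
     (\<forall>x. f differentiable (at x)) \<and>
     (\<forall>i x. grad (\<lambda>x'. f x' $ i) differentiable (at x))"


section \<open>The contextual bandit\<close>

text \<open>
  Actions are the elements of a finite type \<open>'k\<close>, potential outcomes \<open>{Y\<^sub>t(a)}\<close> form the vector
  \<open>Y t \<omega> :: real^'k\<close>, and \<open>P t \<omega> $ a\<close> is the realised probability
  \<open>\<pi>\<^sub>t(a | X\<^sub>t, H\<^sub>t\<^sub>-\<^sub>1)\<close>. Times start at 1; \<open>X 0\<close>, \<open>Y 0\<close>, \<open>P 0\<close>, \<open>A 0\<close> are never used.
  The history up to and including time \<open>t\<close> is kept as a random variable, an element of a finite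
  product; for \<open>t = 0\<close> it is trivial.
\<close>

type_synonym ('x, 'k) record_t = "(real^'x) \<times> (real^'k) \<times> 'k \<times> real"

definition history_space ::
  "nat \<Rightarrow> (nat \<Rightarrow> ('x::finite, 'k::finite) record_t) measure" where
  "history_space t =
     (\<Pi>\<^sub>M \<tau>\<in>{1..t}. borel \<Otimes>\<^sub>M borel \<Otimes>\<^sub>M count_space UNIV \<Otimes>\<^sub>M borel)"

definition history ::
  "(nat \<Rightarrow> 'w \<Rightarrow> real^'x) \<Rightarrow> (nat \<Rightarrow> 'w \<Rightarrow> real^'k) \<Rightarrow> (nat \<Rightarrow> 'w \<Rightarrow> real^'k) \<Rightarrow> (nat \<Rightarrow> 'w \<Rightarrow> 'k)
     \<Rightarrow> nat \<Rightarrow> 'w \<Rightarrow> nat \<Rightarrow> ('x::finite, 'k::finite) record_t" where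
  "history X Y P A t \<omega> = (\<lambda>\<tau>\<in>{1..t}. (X \<tau> \<omega>, P \<tau> \<omega>, A \<tau> \<omega>, Y \<tau> \<omega> $ A \<tau> \<omega>))"

text \<open>The \<open>\<sigma>\<close>-algebra generated by \<open>(H\<^sub>t\<^sub>-\<^sub>1, X\<^sub>t)\<close>.\<close>

definition decision_sigma ::
  "'w measure \<Rightarrow> (nat \<Rightarrow> 'w \<Rightarrow> real^'x) \<Rightarrow> (nat \<Rightarrow> 'w \<Rightarrow> real^'k) \<Rightarrow> (nat \<Rightarrow> 'w \<Rightarrow> real^'k)
     \<Rightarrow> (nat \<Rightarrow> 'w \<Rightarrow> 'k) \<Rightarrow> nat \<Rightarrow> 'w measure" where
  "decision_sigma M X Y P A t =
     vimage_algebra (space M) (\<lambda>\<omega>. (history X Y P A (t - 1) \<omega>, X t \<omega>))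
       (history_space (t - 1) \<Otimes>\<^sub>M (borel :: (real^'x::finite) measure))"

definition contextual_bandit ::
  "'w measure \<Rightarrow> (real^'x) set \<Rightarrow> (nat \<Rightarrow> 'w \<Rightarrow> real^'x) \<Rightarrow> (nat \<Rightarrow> 'w \<Rightarrow> real^'k)
     \<Rightarrow> (nat \<Rightarrow> 'w \<Rightarrow> real^'k) \<Rightarrow> (nat \<Rightarrow> 'w \<Rightarrow> 'k::finite) \<Rightarrow> bool" where
  "contextual_bandit M \<X> X Y P A \<longleftrightarrow>
     prob_space M \<and>
     iid_vars M borel (\<lambda>t \<omega>. (X t \<omega>, Y t \<omega>)) {1..} \<and>
     (\<forall>t\<ge>1. \<forall>\<omega>\<in>space M. X t \<omega> \<in> \<X>) \<and>
     (\<forall>t\<ge>1. A t \<in> measurable M (count_space UNIV)) \<and>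
     (\<forall>t\<ge>1. P t \<in> borel_measurable (decision_sigma M X Y P A t)) \<and>
     (\<forall>t\<ge>1. \<forall>\<omega>\<in>space M. P t \<omega> \<in> prob_simplex) \<and>
     (\<forall>t\<ge>1. \<forall>a. AE \<omega> in M.
        real_cond_exp M (decision_sigma M X Y P A t) (\<lambda>\<omega>. indicator {a} (A t \<omega>)) \<omega> = P t \<omega> $ a) \<and>
     (\<forall>t\<ge>1. indep_rvs M
        borel (\<lambda>\<omega>. (X t \<omega>, Y t \<omega>)) (history_space (t - 1)) (history X Y P A (t - 1)))"

end

theory Submission
  imports Defs
begin

text \<open>
  Unconfoundedness makes the inverse-propensity-weighted score at a fixed \<open>\<theta>\<close>, centred at its
  population value, a square-integrable martingale difference sequence, so its averages converge in
  \<open>L\<^sup>1\<close>. The Jacobian bound makes the scores Lipschitz in \<open>\<theta>\<close> and the convergence uniform over the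
  ball of radius \<open>R\<^sub>\<theta>\<close>; together with identification this gives consistency of the estimators. The
  context \<open>X\<^sub>t\<close> is independent of the estimate it meets and has a fixed law \<open>\<mu>\<close>, so by Fubini the mean
  policy error is the expectation of \<open>k(\<theta>, \<gamma>) = \<integral>\<bar>\<pi>(a | x, \<theta>, \<gamma>) - \<pi>(a | x, \<theta>\<^sup>*, \<gamma>\<^sup>*)\<bar> d\<mu>(x)\<close> at the
  estimate, and \<open>k\<close> tends to 0 at \<open>(\<theta>\<^sup>*, \<gamma>\<^sup>*)\<close> by dominated convergence.
\<close>

section \<open>Measurability and distributions\<close>

text \<open>Three obstacles shape the proof. The estimate at time \<open>t\<close> depends on the
  whole sample, so the weighted scores evaluated at it are not martingale differences; the law of
  large numbers is available only at fixed parameters and must be carried to the random one by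
  Lipschitz bounds valid off a null set that does not depend on the parameter. Conditional
  independence is stated for events of \<open>A t\<close> and of \<open>Y t\<close> separately,
  while the score mixes context and outcome and is multiplied by past data; it is therefore recast
  as the equality of two measures, one weighted by the action indicator and one by the propensity.
  Of the martingale property only orthogonality remains, so a second moment growing linearly in the
  sample size replaces any martingale theorem. Finally, \<open>\<X>\<close> is an arbitrary set and
  the Jacobian bound an arbitrary function, so laws are compared on traces of Borel sets, and the
  bound is replaced by a measurable one before expectations are moved from one time to
  another.\<close>

lemma borel_measurable_caratheodory:
  fixes f :: "'a \<Rightarrow> 'b::{metric_space, second_countable_topology} \<Rightarrow> 'c::{metric_space, second_countable_topology}"
  assumes meas: "\<And>\<theta>. (\<lambda>\<omega>. f \<omega> \<theta>) \<in> borel_measurable M"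
    and cont: "\<And>\<omega>. \<omega> \<in> space M \<Longrightarrow> continuous_on UNIV (f \<omega>)"
    and T: "T \<in> borel_measurable M"
  shows "(\<lambda>\<omega>. f \<omega> (T \<omega>)) \<in> borel_measurable M"
proof -
  \<comment> \<open>A simple function takes finitely many values, so inserting it uses measurability
    at fixed parameters only; continuity in the parameter passes to the limit
    \<open>T\<close>.\<close>
  obtain F where F: "\<And>i. simple_function M (F i)"
      "\<And>\<omega>. \<omega> \<in> space M \<Longrightarrow> (\<lambda>i. F i \<omega>) \<longlonglongrightarrow> T \<omega>"
    using borel_measurable_implies_sequence_metric[OF T, of undefined] by blast
  show ?thesis
  proof (rule borel_measurable_LIMSEQ_metric)
    fix i
    show "(\<lambda>\<omega>. f \<omega> (F i \<omega>)) \<in> borel_measurable M"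
    proof (rule measurable_compose_countable'[where I = "F i ` space M" and f = "\<lambda>\<theta> \<omega>. f \<omega> \<theta>"])
      show "F i \<in> measurable M (count_space (F i ` space M))"
        using simple_functionD(2)[OF F(1)[of i]] simple_functionD(1)[OF F(1)[of i]]
        by (auto intro!: measurableI simp: simple_functionD(2)[OF F(1)])
      show "countable (F i ` space M)"
        using simple_functionD(1)[OF F(1)] by (rule countable_finite)
    qed (rule meas)
  next
    fix \<omega> assume "\<omega> \<in> space M"
    then show "(\<lambda>i. f \<omega> (F i \<omega>)) \<longlonglongrightarrow> f \<omega> (T \<omega>)"
      using F(2) by (intro continuous_on_tendsto_compose[OF cont]) auto
  qed
qed

text \<open>The optimal Lipschitz constant is a supremum over a countable dense set, hence measurable
  even when the given one is not.\<close>

lemma measurable_lipschitz_constant: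
  fixes g :: "'a \<Rightarrow> 'b::{metric_space, second_countable_topology} \<Rightarrow> 'c::{metric_space, second_countable_topology}"
  assumes meas: "\<And>\<theta>. (\<lambda>z. g z \<theta>) \<in> borel_measurable N"
    and lip: "\<And>z \<theta> \<theta>'. z \<in> space N \<Longrightarrow> \<theta> \<in> S \<Longrightarrow> \<theta>' \<in> S \<Longrightarrow> dist (g z \<theta>) (g z \<theta>') \<le> \<phi> z * dist \<theta> \<theta>'"
    and \<phi>: "\<And>z. z \<in> space N \<Longrightarrow> 0 \<le> \<phi> z"
  obtains \<l> :: "'a \<Rightarrow> real" where "\<l> \<in> borel_measurable N"
    "\<And>z. z \<in> space N \<Longrightarrow> 0 \<le> \<l> z" "\<And>z. z \<in> space N \<Longrightarrow> \<l> z \<le> \<phi> z"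
    "\<And>z \<theta> \<theta>'. z \<in> space N \<Longrightarrow> \<theta> \<in> S \<Longrightarrow> \<theta>' \<in> S \<Longrightarrow> dist (g z \<theta>) (g z \<theta>') \<le> \<l> z * dist \<theta> \<theta>'"
proof -
  obtain D where D: "countable D" "D \<subseteq> S" "S \<subseteq> closure D"
    using separable by blast
  \<comment> \<open>Taken in \<open>ennreal\<close>, the supremum exists before any bound is known.
    Pairs on the diagonal contribute 0, since division by 0 yields 0.\<close>
  define L where "L z = (SUP p\<in>D \<times> D. ennreal (dist (g z (fst p)) (g z (snd p)) / dist (fst p) (snd p)))" for z
  have [measurable]: "L \<in> borel_measurable N"
    unfolding L_def using D(1) meas by (intro borel_measurable_SUP) auto
  have L_le: "L z \<le> ennreal (\<phi> z)" if z: "z \<in> space N" for z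
    unfolding L_def
  proof (rule SUP_least)
    fix p assume "p \<in> D \<times> D"
    then have "fst p \<in> S" "snd p \<in> S" using D(2) by auto
    from lip[OF z this] \<phi>[OF z]
    show "ennreal (dist (g z (fst p)) (g z (snd p)) / dist (fst p) (snd p)) \<le> ennreal (\<phi> z)"
      by (intro ennreal_leI) (cases "fst p = snd p"; simp add: divide_le_eq)
  qed
  have L_fin: "ennreal (enn2real (L z)) = L z" if "z \<in> space N" for z
    using L_le[OF that] by (simp add: le_less_trans less_top ennreal_enn2real)
  have lipD: "dist (g z \<theta>) (g z \<theta>') \<le> enn2real (L z) * dist \<theta> \<theta>'"
    if z: "z \<in> space N" and "\<theta> \<in> D" "\<theta>' \<in> D" for z \<theta> \<theta>'
  proof (cases "\<theta> = \<theta>'")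
    case False
    have "ennreal (dist (g z \<theta>) (g z \<theta>') / dist \<theta> \<theta>') \<le> L z"
      unfolding L_def using that by (intro SUP_upper2[of "(\<theta>, \<theta>')"]) auto
    then have "dist (g z \<theta>) (g z \<theta>') / dist \<theta> \<theta>' \<le> enn2real (L z)"
      using L_fin[OF z] by (metis enn2real_nonneg ennreal_le_iff)
    then show ?thesis using False by (simp add: divide_le_eq)
  qed simp
  show ?thesis
  proof (rule that[of "\<lambda>z. enn2real (L z)"])
    fix z assume z: "z \<in> space N"
    show "enn2real (L z) \<le> \<phi> z"
      using L_le[OF z] L_fin[OF z] \<phi>[OF z] by (metis ennreal_le_iff)
    fix \<theta> \<theta>' assume \<theta>: "\<theta> \<in> S" "\<theta>' \<in> S"
    \<comment> \<open>Continuity comes from the given constant \<open>\<phi> z\<close>; it carries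
      the optimal bound from the dense set \<open>D\<close> to all of \<open>S\<close>.\<close>
    have "continuous_on S (g z)"
      using lip[OF z] \<phi>[OF z] by (intro lipschitz_on_continuous_on[where L="\<phi> z"] lipschitz_onI)
    show "dist (g z \<theta>) (g z \<theta>') \<le> enn2real (L z) * dist \<theta> \<theta>'"
    proof -
      obtain u where u: "\<And>n. u n \<in> D" "u \<longlonglongrightarrow> \<theta>"
        using \<theta>(1) D(3) closure_sequential by blast
      obtain v where v: "\<And>n. v n \<in> D" "v \<longlonglongrightarrow> \<theta>'"
        using \<theta>(2) D(3) closure_sequential by blast
      have "(\<lambda>n. g z (u n)) \<longlonglongrightarrow> g z \<theta>" "(\<lambda>n. g z (v n)) \<longlonglongrightarrow> g z \<theta>'"
        using u v \<theta> subsetD[OF D(2)]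
        by (auto intro!: continuous_on_tendsto_compose[OF \<open>continuous_on S (g z)\<close>])
      then show ?thesis
        using u v lipD[OF z]
        by (intro LIMSEQ_le[of "\<lambda>n. dist (g z (u n)) (g z (v n))" _ "\<lambda>n. enn2real (L z) * dist (u n) (v n)"])
          (auto intro!: tendsto_intros)
    qed
  qed auto
qed

text \<open>\<open>S\<close> need not be measurable. An event of the restricted space is a trace
  \<open>S \<inter> C\<close>, and since both variables stay in \<open>S\<close>, its preimage is
  that of \<open>C\<close>.\<close>

lemma distr_restrict_space_cong:
  assumes eq: "distr M N U = distr M N V"
    and U: "U \<in> measurable M N" "\<And>\<omega>. \<omega> \<in> space M \<Longrightarrow> U \<omega> \<in> S"
    and V: "V \<in> measurable M N" "\<And>\<omega>. \<omega> \<in> space M \<Longrightarrow> V \<omega> \<in> S"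
  shows "distr M (restrict_space N S) U = distr M (restrict_space N S) V"
proof (rule measure_eqI)
  fix B assume "B \<in> sets (distr M (restrict_space N S) U)"
  then obtain C where C: "B = S \<inter> C" "C \<in> sets N"
    by (auto simp: sets_restrict_space)
  have "U -` B \<inter> space M = U -` C \<inter> space M" "V -` B \<inter> space M = V -` C \<inter> space M"
    using C U V by auto
  moreover have "emeasure M (U -` C \<inter> space M) = emeasure M (V -` C \<inter> space M)"
    using arg_cong[OF eq, of "\<lambda>\<mu>. emeasure \<mu> C"] C U V by (simp add: emeasure_distr)
  moreover have "U \<in> measurable M (restrict_space N S)" "V \<in> measurable M (restrict_space N S)"
    using U V by (auto intro: measurable_restrict_space2)
  moreover have "B \<in> sets (restrict_space N S)"
    using C by (auto simp: sets_restrict_space)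
  ultimately show "emeasure (distr M (restrict_space N S) U) B = emeasure (distr M (restrict_space N S) V) B"
    by (simp add: emeasure_distr)
qed simp

text \<open>Gives access to the product rule for expectations. Measurability with respect to the
  generated \<sigma>-algebra suffices, so neither variable has to be exhibited as a function of
  \<open>U\<close> or \<open>V\<close>.\<close>

lemma (in prob_space) indep_rvs_indep_var:
  assumes indep: "indep_rvs M N\<^sub>1 U N\<^sub>2 V"
    and f: "f \<in> measurable (vimage_algebra (space M) U N\<^sub>1) N"
    and h: "h \<in> measurable (vimage_algebra (space M) V N\<^sub>2) N"
  shows "indep_var N f N h"
proof -
  let ?A = "vimage_algebra (space M) U N\<^sub>1" and ?B = "vimage_algebra (space M) V N\<^sub>2"
  have ind: "indep_set (sets ?A) (sets ?B)"
    using indep by (simp add: indep_rvs_def)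
  have sub: "sets ?A \<subseteq> events" "sets ?B \<subseteq> events"
    using ind by (auto dest: indep_setD_ev1 indep_setD_ev2)
  have "random_variable N f" "random_variable N h"
    using f h sub by (auto simp: measurable_def)
  moreover have "sigma_sets (space M) {f -` C \<inter> space M |C. C \<in> sets N} \<subseteq> sets ?A"
    using f by (intro sets.sigma_sets_subset[of _ ?A, simplified]) (auto simp: measurable_def)
  moreover have "sigma_sets (space M) {h -` C \<inter> space M |C. C \<in> sets N} \<subseteq> sets ?B"
    using h by (intro sets.sigma_sets_subset[of _ ?B, simplified]) (auto simp: measurable_def)
  ultimately show ?thesis
    unfolding indep_var_eq using sub indep_setD[OF ind]
    by (intro conjI indep_setI) (auto 0 3)
qed

text \<open>The variant for two different value types: it supplies the product law of the context
  and the estimate to which Fubini is applied.\<close>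

lemma (in prob_space) indep_rvs_distr_pair:
  assumes indep: "indep_rvs M N\<^sub>1 U N\<^sub>2 V"
    and f: "f \<in> measurable (vimage_algebra (space M) U N\<^sub>1) L\<^sub>1"
    and h: "h \<in> measurable (vimage_algebra (space M) V N\<^sub>2) L\<^sub>2"
  shows "distr M (L\<^sub>1 \<Otimes>\<^sub>M L\<^sub>2) (\<lambda>\<omega>. (f \<omega>, h \<omega>)) = distr M L\<^sub>1 f \<Otimes>\<^sub>M distr M L\<^sub>2 h"
proof -
  let ?A = "vimage_algebra (space M) U N\<^sub>1" and ?B = "vimage_algebra (space M) V N\<^sub>2"
  have ind: "indep_set (sets ?A) (sets ?B)"
    using indep by (simp add: indep_rvs_def)
  have sub: "sets ?A \<subseteq> events" "sets ?B \<subseteq> events"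
    using ind by (auto dest: indep_setD_ev1 indep_setD_ev2)
  have [measurable]: "random_variable L\<^sub>1 f" "random_variable L\<^sub>2 h"
    using f h sub by (auto simp: measurable_def)
  interpret f: prob_space "distr M L\<^sub>1 f" by (rule prob_space_distr) simp
  interpret h: prob_space "distr M L\<^sub>2 h" by (rule prob_space_distr) simp
  have "distr M L\<^sub>1 f \<Otimes>\<^sub>M distr M L\<^sub>2 h = distr M (L\<^sub>1 \<Otimes>\<^sub>M L\<^sub>2) (\<lambda>\<omega>. (f \<omega>, h \<omega>))"
  proof (rule pair_measure_eqI)
    fix A B assume "A \<in> sets (distr M L\<^sub>1 f)" "B \<in> sets (distr M L\<^sub>2 h)"
    then have [measurable]: "A \<in> sets L\<^sub>1" "B \<in> sets L\<^sub>2" by auto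
    have "f -` A \<inter> space M \<in> sets ?A" "h -` B \<inter> space M \<in> sets ?B"
      using measurable_sets[OF f, of A] measurable_sets[OF h, of B] by auto
    from indep_setD[OF ind this]
    have "prob ((f -` A \<inter> space M) \<inter> (h -` B \<inter> space M)) = prob (f -` A \<inter> space M) * prob (h -` B \<inter> space M)" .
    moreover have "(\<lambda>\<omega>. (f \<omega>, h \<omega>)) -` (A \<times> B) \<inter> space M = (f -` A \<inter> space M) \<inter> (h -` B \<inter> space M)"
      by auto
    ultimately show "emeasure (distr M L\<^sub>1 f) A * emeasure (distr M L\<^sub>2 h) B
        = emeasure (distr M (L\<^sub>1 \<Otimes>\<^sub>M L\<^sub>2) (\<lambda>\<omega>. (f \<omega>, h \<omega>))) (A \<times> B)"
      by (simp add: emeasure_distr emeasure_eq_measure ennreal_mult'')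
  qed (unfold_locales, simp)
  then show ?thesis by simp
qed

section \<open>Convergence in probability\<close>

text \<open>Markov's inequality. Integrability is asked only eventually because the variables at
  time 0 are unconstrained.\<close>

lemma (in prob_space) converges_in_prob_L1:
  fixes Z :: "nat \<Rightarrow> 'a \<Rightarrow> real"
  assumes int: "\<forall>\<^sub>F t in sequentially. integrable M (Z t)"
    and lim: "(\<lambda>t. \<integral>\<omega>. \<bar>Z t \<omega>\<bar> \<partial>M) \<longlonglongrightarrow> 0"
  shows "converges_in_prob M Z (\<lambda>_. 0)"
  unfolding converges_in_prob_def
proof (intro allI impI)
  fix \<epsilon> :: real assume \<epsilon>: "\<epsilon> > 0"
  have "(\<lambda>t. (\<integral>\<omega>. \<bar>Z t \<omega>\<bar> \<partial>M) / \<epsilon>) \<longlonglongrightarrow> 0"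
    using tendsto_divide[OF lim tendsto_const, of \<epsilon>] \<epsilon> by simp
  then show "(\<lambda>t. prob {\<omega> \<in> space M. norm (Z t \<omega> - 0) > \<epsilon>}) \<longlonglongrightarrow> 0"
  proof (rule tendsto_sandwich[OF _ _ tendsto_const, rotated 2])
    show "\<forall>\<^sub>F t in sequentially. prob {\<omega> \<in> space M. norm (Z t \<omega> - 0) > \<epsilon>} \<le> (\<integral>\<omega>. \<bar>Z t \<omega>\<bar> \<partial>M) / \<epsilon>"
      using int
    proof eventually_elim
      case (elim t)
      then have [measurable]: "Z t \<in> borel_measurable M" by auto
      have "prob {\<omega> \<in> space M. norm (Z t \<omega> - 0) > \<epsilon>} \<le> prob {\<omega> \<in> space M. \<bar>Z t \<omega>\<bar> \<ge> \<epsilon>}"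
        by (intro finite_measure_mono) auto
      also have "\<dots> \<le> (\<integral>\<omega>. \<bar>Z t \<omega>\<bar> \<partial>M) / \<epsilon>"
        using elim \<epsilon> by (intro integral_Markov_inequality_measure[where A="{}"]) auto
      finally show ?case .
    qed
  qed auto
qed

text \<open>This is nonnegativity of the variance of \<open>\<bar>Z \<omega>\<bar>\<close>.\<close>

lemma (in prob_space) expectation_abs_le_sqrt:
  fixes Z :: "'a \<Rightarrow> real"
  assumes [measurable]: "Z \<in> borel_measurable M" and int: "integrable M (\<lambda>\<omega>. (Z \<omega>)\<^sup>2)"
  shows "(\<integral>\<omega>. \<bar>Z \<omega>\<bar> \<partial>M) \<le> sqrt (\<integral>\<omega>. (Z \<omega>)\<^sup>2 \<partial>M)"
proof (rule real_le_rsqrt)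
  have "integrable M Z" using square_integrable_imp_integrable[OF _ int] by simp
  then show "(\<integral>\<omega>. \<bar>Z \<omega>\<bar> \<partial>M)\<^sup>2 \<le> (\<integral>\<omega>. (Z \<omega>)\<^sup>2 \<partial>M)"
    using variance_eq[of "\<lambda>\<omega>. \<bar>Z \<omega>\<bar>"] variance_positive[of "\<lambda>\<omega>. \<bar>Z \<omega>\<bar>"] int by simp
qed

text \<open>\<open>U t\<close> keeps a fixed law without converging, and continuity in
  \<open>v\<close> is not uniform in \<open>x\<close>. Independence allows averaging over
  \<open>x\<close> first, which leaves a single function of \<open>V t\<close>.\<close>

lemma (in prob_space) converges_in_prob_compose_indep:
  fixes F :: "'x \<Rightarrow> 'v::{metric_space, second_countable_topology} \<Rightarrow> real"
  assumes U: "\<And>t. t \<ge> 1 \<Longrightarrow> U t \<in> measurable M N" "\<And>t. t \<ge> 1 \<Longrightarrow> distr M N (U t) = \<mu>"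
    and V: "\<And>t. t \<ge> 1 \<Longrightarrow> V t \<in> borel_measurable M"
    and prod: "\<And>t. t \<ge> 1 \<Longrightarrow> distr M (N \<Otimes>\<^sub>M borel) (\<lambda>\<omega>. (U t \<omega>, V t \<omega>)) = distr M N (U t) \<Otimes>\<^sub>M distr M borel (V t)"
    and F: "case_prod F \<in> borel_measurable (N \<Otimes>\<^sub>M borel)"
    and bnd: "\<And>x v. x \<in> space N \<Longrightarrow> \<bar>F x v\<bar> \<le> B"
    and cont: "AE x in \<mu>. isCont (F x) v"
    and lim: "\<And>\<epsilon>. \<epsilon> > 0 \<Longrightarrow> (\<lambda>t. prob {\<omega> \<in> space M. dist (V t \<omega>) v > \<epsilon>}) \<longlonglongrightarrow> 0"
  shows "converges_in_prob M (\<lambda>t \<omega>. F (U t \<omega>) (V t \<omega>) - F (U t \<omega>) v) (\<lambda>_. 0)"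
proof -
  note F[measurable]
  have [simp]: "sets \<mu> = sets N" "space \<mu> = space N" using U(2)[of 1] by auto
  have [measurable_cong]: "sets \<mu> = sets N" by simp
  interpret \<mu>: prob_space \<mu> using prob_space_distr[OF U(1)[of 1]] U(2)[of 1] by simp
  have Fm[measurable]: "(\<lambda>x. F x w) \<in> borel_measurable N" for w by measurable
  define G where "G x w = \<bar>F x w - F x v\<bar>" for x w
  have G[measurable]: "case_prod G \<in> borel_measurable (N \<Otimes>\<^sub>M borel)"
    unfolding G_def by measurable
  have Gb: "0 \<le> G x w" "G x w \<le> 2 * B" if "x \<in> space N" for x w
    using bnd[OF that, of w] bnd[OF that, of v] by (auto simp: G_def)
  obtain x0 where "x0 \<in> space N" using \<mu>.not_empty by auto
  then have B: "B \<ge> 0" using bnd[of x0 v] by linarith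
  define k where "k w = (\<integral>x. G x w \<partial>\<mu>)" for w
  have k[measurable]: "k \<in> borel_measurable borel"
    unfolding k_def using G by (intro \<mu>.borel_measurable_lebesgue_integral) measurable
  have Gi: "integrable \<mu> (\<lambda>x. G x w)" for w
    using Gb by (intro \<mu>.integrable_const_bound[where B="2*B"]) auto
  have k01: "0 \<le> k w" "k w \<le> 2 * B" for w
  proof -
    show "0 \<le> k w" unfolding k_def using Gb by (intro integral_nonneg_AE AE_I2) simp
    show "k w \<le> 2 * B" unfolding k_def using Gi Gb by (intro \<mu>.integral_le_const AE_I2) auto
  qed
  have k_cont: "(k \<longlongrightarrow> 0) (at v)"
    unfolding tendsto_at_iff_sequentially
  proof safe
    fix w :: "nat \<Rightarrow> 'v" assume w: "w \<longlonglongrightarrow> v"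
    have "(\<lambda>i. \<integral>x. G x (w i) \<partial>\<mu>) \<longlonglongrightarrow> (\<integral>x. 0 \<partial>\<mu>)"
    proof (rule integral_dominated_convergence[where w="\<lambda>_::'x. 2*B"])
      show "AE x in \<mu>. (\<lambda>i. G x (w i)) \<longlonglongrightarrow> 0"
        using cont
      proof eventually_elim
        case (elim x)
        then have "(\<lambda>i. F x (w i)) \<longlonglongrightarrow> F x v" using w by (rule isCont_tendsto_compose)
        then show ?case unfolding G_def by (simp add: LIM_zero tendsto_rabs_zero)
      qed
    qed (use Gb in auto)
    then show "(k \<circ> w) \<longlonglongrightarrow> 0" by (simp add: k_def comp_def)
  qed
  \<comment> \<open>The limit \<open>at v\<close> says nothing about \<open>v\<close> itself, a
    value that \<open>V t\<close> may take.\<close>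
  have kv: "k v = 0" by (simp add: k_def G_def)
  have E: "(\<integral>\<omega>. \<bar>F (U t \<omega>) (V t \<omega>) - F (U t \<omega>) v\<bar> \<partial>M) = (\<integral>\<omega>. k (V t \<omega>) \<partial>M)" if t: "t \<ge> 1" for t
  proof -
    note U(1)[OF t, measurable] V[OF t, measurable]
    interpret V: prob_space "distr M borel (V t)" by (rule prob_space_distr) simp
    interpret P: pair_sigma_finite \<mu> "distr M borel (V t)" ..
    have pr: "distr M (N \<Otimes>\<^sub>M borel) (\<lambda>\<omega>. (U t \<omega>, V t \<omega>)) = \<mu> \<Otimes>\<^sub>M distr M borel (V t)"
      using prod[OF t] U(2)[OF t] by simp
    interpret PP: prob_space "\<mu> \<Otimes>\<^sub>M distr M borel (V t)"
      unfolding pr[symmetric] by (rule prob_space_distr) measurable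
    have int: "integrable (\<mu> \<Otimes>\<^sub>M distr M borel (V t)) (case_prod G)"
      using Gb by (intro PP.integrable_const_bound[where B="2*B"]) (auto simp: space_pair_measure)
    have "(\<integral>\<omega>. \<bar>F (U t \<omega>) (V t \<omega>) - F (U t \<omega>) v\<bar> \<partial>M) = (\<integral>z. case_prod G z \<partial>(\<mu> \<Otimes>\<^sub>M distr M borel (V t)))"
      unfolding pr[symmetric] by (subst integral_distr) (auto simp: G_def)
    also have "\<dots> = (\<integral>w. k w \<partial>distr M borel (V t))"
      unfolding k_def using P.integral_snd[OF int] by simp
    also have "\<dots> = (\<integral>\<omega>. k (V t \<omega>) \<partial>M)" by (subst integral_distr) auto
    finally show ?thesis .
  qed
  have lim0: "(\<lambda>t. \<integral>\<omega>. k (V t \<omega>) \<partial>M) \<longlonglongrightarrow> 0"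
  proof (rule LIMSEQ_I)
    fix r :: real assume r: "r > 0"
    obtain \<delta> where \<delta>: "\<delta> > 0" "\<And>w. w \<noteq> v \<Longrightarrow> dist w v < \<delta> \<Longrightarrow> dist (k w) 0 < r/2"
      using tendstoD[OF k_cont, of "r/2"] r unfolding eventually_at by auto
    \<comment> \<open>Halving the radius keeps the points outside the strict indicator, at distance
      at most \<open>\<delta>/2\<close>, strictly within \<open>\<delta>\<close>.\<close>
    have k\<delta>: "k w \<le> r/2 + 2 * B * indicator {w. dist w v > \<delta>/2} w" for w
      using \<delta>(2)[of w] \<delta>(1) k01[of w] kv r by (cases "w = v"; cases "dist w v > \<delta>/2") auto
    have "(\<lambda>t. 2 * B * prob {\<omega> \<in> space M. dist (V t \<omega>) v > \<delta>/2}) \<longlonglongrightarrow> 0"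
      using tendsto_mult_right_zero[OF lim[of "\<delta>/2"]] \<delta>(1) by simp
    from LIMSEQ_D[OF this, of "r/2"] r obtain n where
      n': "\<forall>t\<ge>n. norm (2 * B * prob {\<omega> \<in> space M. dist (V t \<omega>) v > \<delta>/2} - 0) < r/2" by auto
    have n: "2 * B * prob {\<omega> \<in> space M. dist (V t \<omega>) v > \<delta>/2} < r/2" if "t \<ge> n" for t
      using n'[rule_format, OF that] unfolding real_norm_def by linarith
    show "\<exists>no. \<forall>t\<ge>no. norm ((\<integral>\<omega>. k (V t \<omega>) \<partial>M) - 0) < r"
    proof (intro exI[of _ "max n 1"] allI impI)
      fix t assume t: "max n 1 \<le> t"
      then have [measurable]: "V t \<in> borel_measurable M" using V by auto
      define Q where "Q = {\<omega> \<in> space M. dist (V t \<omega>) v > \<delta>/2}"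
      have [measurable]: "Q \<in> sets M" unfolding Q_def by measurable
      have Q: "integrable M (\<lambda>\<omega>. indicator Q \<omega> :: real)"
        by (intro integrable_real_indicator) (auto simp: emeasure_eq_measure)
      have "(\<integral>\<omega>. k (V t \<omega>) \<partial>M) \<le> (\<integral>\<omega>. r/2 + 2 * B * indicator Q \<omega> \<partial>M)"
      proof (rule integral_mono)
        show "integrable M (\<lambda>\<omega>. k (V t \<omega>))"
          using k01 by (intro integrable_const_bound[where B="2*B"]) auto
        show "k (V t \<omega>) \<le> r/2 + 2 * B * indicator Q \<omega>" if "\<omega> \<in> space M" for \<omega>
          using k\<delta>[of "V t \<omega>"] that by (simp add: indicator_def Q_def)
      qed (use Q in auto)
      also have "\<dots> = r/2 + 2 * B * prob Q"
        using Q sets.Int_space_eq2[of Q M] by (simp add: prob_space)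
      also have "\<dots> < r" using n[of t] t unfolding Q_def by simp
      finally show "norm ((\<integral>\<omega>. k (V t \<omega>) \<partial>M) - 0) < r"
        using k01 by (simp add: integral_nonneg_AE)
    qed
  qed
  show ?thesis
  proof (rule converges_in_prob_L1)
    show "\<forall>\<^sub>F t in sequentially. integrable M (\<lambda>\<omega>. F (U t \<omega>) (V t \<omega>) - F (U t \<omega>) v)"
      using eventually_ge_at_top[of "1::nat"]
    proof eventually_elim
      case (elim t)
      note U(1)[OF elim, measurable] V[OF elim, measurable]
      have "U t \<omega> \<in> space N" if "\<omega> \<in> space M" for \<omega>
        using measurable_space[OF U(1)[OF elim] that] .
      then show ?case
        using bnd by (intro Bochner_Integration.integrable_diff integrable_const_bound[where B=B]) auto
    qed
    show "(\<lambda>t. \<integral>\<omega>. \<bar>F (U t \<omega>) (V t \<omega>) - F (U t \<omega>) v\<bar> \<partial>M) \<longlonglongrightarrow> 0"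
      by (rule Lim_transform_eventually[OF lim0], rule eventually_mono[OF eventually_ge_at_top[of 1]])
        (simp add: E)
  qed
qed

section \<open>Inverse propensity weighting\<close>

lemma borel_measurable_vec_nth[measurable]: "(\<lambda>v::real^'n. v $ i) \<in> borel_measurable borel"
  by (intro borel_measurable_continuous_onI continuous_intros)

locale bandit_process =
  fixes M :: "'w measure"
    and \<X> :: "(real^'x::finite) set"
    and X :: "nat \<Rightarrow> 'w \<Rightarrow> real^'x"
    and Y P :: "nat \<Rightarrow> 'w \<Rightarrow> real^'k::finite"
    and A :: "nat \<Rightarrow> 'w \<Rightarrow> 'k"
  assumes bandit: "contextual_bandit M \<X> X Y P A"
begin

sublocale prob_space M
  using bandit by (simp add: contextual_bandit_def)

abbreviation "ctx_space \<equiv> restrict_space borel \<X>"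
text \<open>Independence links \<open>hist_sigma (t - 1)\<close> with \<open>draw_sigma t\<close>;
  unconfoundedness is conditional on \<open>dec_sigma t\<close>, which joins the past with
  \<open>X t\<close>.\<close>

abbreviation "hist_sigma t \<equiv> vimage_algebra (space M) (history X Y P A t) (history_space t)"
abbreviation "draw_sigma t \<equiv> vimage_algebra (space M) (\<lambda>\<omega>. (X t \<omega>, Y t \<omega>)) borel"
abbreviation "dec_sigma t \<equiv> decision_sigma M X Y P A t"

lemma X_in: "t \<ge> 1 \<Longrightarrow> \<omega> \<in> space M \<Longrightarrow> X t \<omega> \<in> \<X>"
  using bandit by (simp add: contextual_bandit_def)

lemma A_measurable: "t \<ge> 1 \<Longrightarrow> A t \<in> measurable M (count_space UNIV)"
  using bandit by (simp add: contextual_bandit_def)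

lemma XY_measurable: "t \<ge> 1 \<Longrightarrow> (\<lambda>\<omega>. (X t \<omega>, Y t \<omega>)) \<in> borel_measurable M"
  using bandit by (auto simp: contextual_bandit_def iid_vars_def indep_vars_def)

lemma X_measurable: "t \<ge> 1 \<Longrightarrow> X t \<in> borel_measurable M"
  and Y_measurable: "t \<ge> 1 \<Longrightarrow> Y t \<in> borel_measurable M"
  using XY_measurable[of t] by (auto simp: borel_prod[symmetric] measurable_pair_iff comp_def)

lemma X_ctx: "t \<ge> 1 \<Longrightarrow> X t \<in> measurable M ctx_space"
  using X_measurable X_in by (auto intro: measurable_restrict_space2)

lemma Y_draw: "Y t \<in> borel_measurable (draw_sigma t)"
proof -
  have "(\<lambda>\<omega>. (X t \<omega>, Y t \<omega>)) \<in> borel_measurable (draw_sigma t)"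
    by (rule measurable_vimage_algebra1) auto
  then show ?thesis
    by (auto simp: borel_prod[symmetric] measurable_pair_iff comp_def)
qed

lemma X_draw:
  assumes "t \<ge> 1"
  shows "X t \<in> measurable (draw_sigma t) ctx_space"
proof -
  have "(\<lambda>\<omega>. (X t \<omega>, Y t \<omega>)) \<in> borel_measurable (draw_sigma t)"
    by (rule measurable_vimage_algebra1) auto
  then have "X t \<in> borel_measurable (draw_sigma t)"
    by (auto simp: borel_prod[symmetric] measurable_pair_iff comp_def)
  then show ?thesis
    using X_in[OF assms] by (auto intro: measurable_restrict_space2)
qed

lemma indep_rvs_history:
  "t \<ge> 1 \<Longrightarrow> indep_rvs M borel (\<lambda>\<omega>. (X t \<omega>, Y t \<omega>)) (history_space (t - 1)) (history X Y P A (t - 1))"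
  using bandit by (simp add: contextual_bandit_def)

lemma history_measurable: "history X Y P A t \<in> measurable M (history_space t)"
  using indep_rvs_history[of "Suc t"] by (simp add: indep_rvs_def)

lemma subalgebra_hist: "subalgebra M (hist_sigma t)"
  using history_measurable[of t]
  by (auto simp: subalgebra_def sets_vimage_algebra2 measurable_def)

lemma history_hist: "history X Y P A t \<in> measurable (hist_sigma t) (history_space t)"
  using history_measurable[of t] by (intro measurable_vimage_algebra1) (auto simp: measurable_def)

lemma dec_pair_measurable:
  assumes "t \<ge> 1"
  shows "(\<lambda>\<omega>. (history X Y P A (t - 1) \<omega>, X t \<omega>)) \<in> measurable M (history_space (t - 1) \<Otimes>\<^sub>M borel)"
  using history_measurable X_measurable[OF assms] by (intro measurable_Pair)

lemma space_dec[simp]: "space (dec_sigma t) = space M"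
  by (simp add: decision_sigma_def)

lemma dec_pair_dec:
  assumes "t \<ge> 1"
  shows "(\<lambda>\<omega>. (history X Y P A (t - 1) \<omega>, X t \<omega>)) \<in> measurable (dec_sigma t) (history_space (t - 1) \<Otimes>\<^sub>M borel)"
  unfolding decision_sigma_def
  using measurable_space[OF dec_pair_measurable[OF assms]] by (intro measurable_vimage_algebra1) auto

lemma subalgebra_dec: "t \<ge> 1 \<Longrightarrow> subalgebra M (dec_sigma t)"
  using dec_pair_measurable[of t]
  by (auto simp: subalgebra_def decision_sigma_def sets_vimage_algebra2 measurable_def)

lemma X_dec: "t \<ge> 1 \<Longrightarrow> X t \<in> measurable (dec_sigma t) ctx_space"
  using measurable_compose[OF dec_pair_dec[of t] measurable_snd] X_in[of t]
  by (auto intro!: measurable_restrict_space2)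

lemma subalgebra_dec_hist:
  assumes "t \<ge> 1"
  shows "subalgebra (dec_sigma t) (hist_sigma (t - 1))"
proof -
  have "history X Y P A (t - 1) \<in> measurable (dec_sigma t) (history_space (t - 1))"
    using measurable_compose[OF dec_pair_dec[OF assms] measurable_fst] by simp
  then show ?thesis
    by (auto simp: subalgebra_def sets_vimage_algebra2 measurable_def)
qed

lemma P_dec: "t \<ge> 1 \<Longrightarrow> P t \<in> borel_measurable (dec_sigma t)"
  using bandit by (simp add: contextual_bandit_def)

lemma P_measurable: "t \<ge> 1 \<Longrightarrow> P t \<in> borel_measurable M"
  using P_dec subalgebra_dec measurable_from_subalg by blast

lemma P_nonneg: "t \<ge> 1 \<Longrightarrow> \<omega> \<in> space M \<Longrightarrow> 0 \<le> P t \<omega> $ a"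
  using bandit by (simp add: contextual_bandit_def prob_simplex_def)

lemma P_le_1:
  assumes "t \<ge> 1" "\<omega> \<in> space M"
  shows "P t \<omega> $ a \<le> 1"
proof -
  have "(\<Sum>b\<in>UNIV. P t \<omega> $ b) = 1"
    using bandit assms by (simp add: contextual_bandit_def prob_simplex_def)
  then show ?thesis
    using member_le_sum[of a UNIV "\<lambda>b. P t \<omega> $ b"] P_nonneg[OF assms] by simp
qed

lemma record_hist:
  assumes "1 \<le> s" "s \<le> t"
  shows "(\<lambda>\<omega>. (X s \<omega>, P s \<omega>, A s \<omega>, Y s \<omega> $ A s \<omega>)) \<in>
    measurable (hist_sigma t) (borel \<Otimes>\<^sub>M borel \<Otimes>\<^sub>M count_space UNIV \<Otimes>\<^sub>M borel)"
proof -
  have "(\<lambda>\<omega>. history X Y P A t \<omega> s) \<in> measurable (hist_sigma t) (borel \<Otimes>\<^sub>M borel \<Otimes>\<^sub>M count_space UNIV \<Otimes>\<^sub>M borel)"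
    using assms history_hist[of t]
    by (auto simp: history_space_def intro: measurable_compose[OF _ measurable_component_singleton])
  then show ?thesis
    using assms by (simp add: history_def)
qed

lemma outcome_ctx: "t \<ge> 1 \<Longrightarrow> (\<lambda>\<omega>. (X t \<omega>, Y t \<omega> $ a)) \<in> measurable M (ctx_space \<Otimes>\<^sub>M borel)"
  using X_ctx[of t] measurable_compose[OF Y_measurable borel_measurable_vec_nth] by (intro measurable_Pair)

text \<open>The laws are compared on the trace space because integrands are measurable only over
  contexts in \<open>\<X>\<close>. Through the two projections this reduces every later moment to
  time 1.\<close>

lemma distr_XY:
  assumes "t \<ge> 1"
  shows "distr M (restrict_space borel (\<X> \<times> UNIV)) (\<lambda>\<omega>. (X t \<omega>, Y t \<omega>)) =
    distr M (restrict_space borel (\<X> \<times> UNIV)) (\<lambda>\<omega>. (X 1 \<omega>, Y 1 \<omega>))"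
proof (rule distr_restrict_space_cong)
  have "\<forall>i\<in>{1..}. \<forall>j\<in>{1..}. distr M borel (\<lambda>\<omega>. (X i \<omega>, Y i \<omega>)) = distr M borel (\<lambda>\<omega>. (X j \<omega>, Y j \<omega>))"
    using bandit unfolding contextual_bandit_def iid_vars_def by blast
  then show "distr M borel (\<lambda>\<omega>. (X t \<omega>, Y t \<omega>)) = distr M borel (\<lambda>\<omega>. (X 1 \<omega>, Y 1 \<omega>))"
    using assms by blast
qed (use assms X_in XY_measurable in auto)

lemma XY_ctx: "t \<ge> 1 \<Longrightarrow> (\<lambda>\<omega>. (X t \<omega>, Y t \<omega>)) \<in> measurable M (restrict_space borel (\<X> \<times> UNIV))"
  using XY_measurable X_in by (intro measurable_restrict_space2) auto

lemma fst_ctx: "fst \<in> measurable (restrict_space borel (\<X> \<times> (UNIV :: (real^'k) set))) ctx_space"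
  by (intro measurable_restrict_space2 measurable_restrict_space1)
    (auto simp: space_restrict_space borel_prod[symmetric])

lemma snd_ctx: "snd \<in> borel_measurable (restrict_space borel (\<X> \<times> (UNIV :: (real^'k) set)))"
  by (intro measurable_restrict_space1) (simp add: borel_prod[symmetric])

lemma distr_X: "t \<ge> 1 \<Longrightarrow> distr M ctx_space (X t) = distr M ctx_space (X 1)"
  using arg_cong[OF distr_XY[of t], of "\<lambda>\<mu>. distr \<mu> ctx_space fst"] fst_ctx XY_ctx[of t] XY_ctx[of 1]
  by (simp add: distr_distr comp_def)

lemma distr_outcome:
  assumes "t \<ge> 1"
  shows "distr M (ctx_space \<Otimes>\<^sub>M borel) (\<lambda>\<omega>. (X t \<omega>, Y t \<omega> $ a)) = distr M (ctx_space \<Otimes>\<^sub>M borel) (\<lambda>\<omega>. (X 1 \<omega>, Y 1 \<omega> $ a))"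
proof -
  note fst_ctx[measurable] snd_ctx[measurable]
  have "(\<lambda>z. (fst z, snd z $ a)) \<in> measurable (restrict_space borel (\<X> \<times> (UNIV :: (real^'k) set))) (ctx_space \<Otimes>\<^sub>M borel)"
    by measurable
  then show ?thesis
    using arg_cong[OF distr_XY[OF assms], of "\<lambda>\<mu>. distr \<mu> (ctx_space \<Otimes>\<^sub>M borel) (\<lambda>z. (fst z, snd z $ a))"]
      XY_ctx[OF assms] XY_ctx[of 1]
    by (simp add: distr_distr comp_def)
qed

lemma
  fixes f :: "(real^'x) \<times> real \<Rightarrow> 'b::{banach, second_countable_topology}"
  assumes "t \<ge> 1" and "f \<in> borel_measurable (ctx_space \<Otimes>\<^sub>M borel)"
  shows integrable_outcome: "integrable M (\<lambda>\<omega>. f (X t \<omega>, Y t \<omega> $ a)) \<longleftrightarrow> integrable M (\<lambda>\<omega>. f (X 1 \<omega>, Y 1 \<omega> $ a))"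
    and integral_outcome: "(\<integral>\<omega>. f (X t \<omega>, Y t \<omega> $ a) \<partial>M) = (\<integral>\<omega>. f (X 1 \<omega>, Y 1 \<omega> $ a) \<partial>M)"
  using integrable_distr_eq[OF outcome_ctx[of t a] assms(2)] integrable_distr_eq[OF outcome_ctx[of 1 a] assms(2)]
    integral_distr[OF outcome_ctx[of t a] assms(2)] integral_distr[OF outcome_ctx[of 1 a] assms(2)] assms(1)
  by (simp_all add: distr_outcome[of t a])

text \<open>Written with the observed outcome and the propensity of the drawn action, the term is a
  function of one history record, hence measurable for the past at later times. The indicator allows
  \<open>A t \<omega>\<close> to be replaced by \<open>a\<close>, the form used for
  expectations.\<close>

definition ipw :: "'k \<Rightarrow> ((real^'x) \<times> real \<Rightarrow> 'b::real_vector) \<Rightarrow> nat \<Rightarrow> 'w \<Rightarrow> 'b" where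
  "ipw a f t \<omega> = (indicator {a} (A t \<omega>) / P t \<omega> $ A t \<omega>) *\<^sub>R f (X t \<omega>, Y t \<omega> $ A t \<omega>)"

lemma ipw_eq: "ipw a f t \<omega> = (indicator {a} (A t \<omega>) / P t \<omega> $ a) *\<^sub>R f (X t \<omega>, Y t \<omega> $ a)"
  by (simp add: ipw_def indicator_def)

lemma ipw_hist:
  fixes f :: "(real^'x) \<times> real \<Rightarrow> 'b::{real_normed_vector, second_countable_topology}"
  assumes s: "1 \<le> s" "s \<le> t" and f: "f \<in> borel_measurable (ctx_space \<Otimes>\<^sub>M borel)"
  shows "ipw a f s \<in> borel_measurable (hist_sigma t)"
proof -
  let ?H = "hist_sigma t"
  note r = record_hist[OF s]
  have X: "X s \<in> measurable ?H ctx_space"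
    using measurable_compose[OF r measurable_fst] X_in s by (auto intro!: measurable_restrict_space2)
  note r2 = measurable_compose[OF r measurable_snd]
  note r3 = measurable_compose[OF r2 measurable_snd]
  have P: "P s \<in> borel_measurable ?H"
    using measurable_compose[OF r2 measurable_fst] by simp
  have A[measurable]: "A s \<in> measurable ?H (count_space UNIV)"
    using measurable_compose[OF r3 measurable_fst] by simp
  have Y: "(\<lambda>\<omega>. Y s \<omega> $ A s \<omega>) \<in> borel_measurable ?H"
    using measurable_compose[OF r3 measurable_snd] by simp
  have [measurable]: "(\<lambda>\<omega>. P s \<omega> $ b) \<in> borel_measurable ?H" for b
    by (rule measurable_compose[OF P borel_measurable_vec_nth])
  have [measurable]: "(\<lambda>\<omega>. P s \<omega> $ A s \<omega>) \<in> borel_measurable ?H"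
    by (rule measurable_compose_countable[OF _ A]) simp
  have [measurable]: "(\<lambda>\<omega>. f (X s \<omega>, Y s \<omega> $ A s \<omega>)) \<in> borel_measurable ?H"
    using X Y by (intro measurable_compose[OF _ f] measurable_Pair)
  show ?thesis
    unfolding ipw_def by measurable
qed

lemma ipw_measurable:
  fixes f :: "(real^'x) \<times> real \<Rightarrow> 'b::{real_normed_vector, second_countable_topology}"
  assumes "1 \<le> s" and "f \<in> borel_measurable (ctx_space \<Otimes>\<^sub>M borel)"
  shows "ipw a f s \<in> borel_measurable M"
  using ipw_hist[OF assms(1) order_refl assms(2)] measurable_from_subalg[OF subalgebra_hist] by blast

text \<open>\<open>U\<close> is past information and \<open>h\<close> reads the current draw, so the
  two are independent. The outcome here is the potential one; selection by \<open>A t\<close> enters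
  only afterwards.\<close>

lemma
  fixes U :: "'w \<Rightarrow> real" and h :: "(real^'x) \<times> real \<Rightarrow> real"
  assumes t: "t \<ge> 1"
    and U: "U \<in> borel_measurable (hist_sigma (t - 1))" "integrable M U"
    and h: "h \<in> borel_measurable (ctx_space \<Otimes>\<^sub>M borel)" "integrable M (\<lambda>\<omega>. h (X t \<omega>, Y t \<omega> $ a))"
  shows integrable_past_times_outcome: "integrable M (\<lambda>\<omega>. U \<omega> * h (X t \<omega>, Y t \<omega> $ a))"
    and integral_past_times_outcome:
      "(\<integral>\<omega>. U \<omega> * h (X t \<omega>, Y t \<omega> $ a) \<partial>M) = (\<integral>\<omega>. U \<omega> \<partial>M) * (\<integral>\<omega>. h (X t \<omega>, Y t \<omega> $ a) \<partial>M)"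
proof -
  note X_draw[OF t, measurable] Y_draw[of t, measurable]
  have "(\<lambda>\<omega>. h (X t \<omega>, Y t \<omega> $ a)) \<in> borel_measurable (draw_sigma t)"
    by (rule measurable_compose[OF _ h(1)]) measurable
  from indep_rvs_indep_var[OF indep_rvs_history[OF t] this U(1)]
  have ind: "indep_var borel (\<lambda>\<omega>. h (X t \<omega>, Y t \<omega> $ a)) borel U" .
  show "integrable M (\<lambda>\<omega>. U \<omega> * h (X t \<omega>, Y t \<omega> $ a))"
    "(\<integral>\<omega>. U \<omega> * h (X t \<omega>, Y t \<omega> $ a) \<partial>M) = (\<integral>\<omega>. U \<omega> \<partial>M) * (\<integral>\<omega>. h (X t \<omega>, Y t \<omega> $ a) \<partial>M)"
    using indep_var_integrable[OF ind h(2) U(2)] indep_var_lebesgue_integral[OF ind h(2) U(2)]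
    by (simp_all add: mult.commute)
qed

end

section \<open>Unconfoundedness as a change of measure from action indicator to propensity\<close>

locale ipw_bandit = bandit_process M \<X> X Y P A
  for M :: "'w measure"
    and \<X> :: "(real^'x::finite) set"
    and X :: "nat \<Rightarrow> 'w \<Rightarrow> real^'x"
    and Y P :: "nat \<Rightarrow> 'w \<Rightarrow> real^'k::finite"
    and A :: "nat \<Rightarrow> 'w \<Rightarrow> 'k" +
  fixes \<pi>min :: real
  assumes unconfounded: "\<And>t. t \<ge> 1 \<Longrightarrow>
      cond_indep_var M (decision_sigma M X Y P A t) (count_space UNIV) (A t) borel (Y t)"
    and \<pi>min: "0 < \<pi>min"
    and overlap: "\<And>a t. t \<ge> 1 \<Longrightarrow> AE \<omega> in M. P t \<omega> $ a \<ge> \<pi>min"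
begin

text \<open>Given \<open>dec_sigma t\<close>, unconfoundedness splits the joint probability into the
  propensity times the conditional probability of \<open>B\<close>. Since
  \<open>indicator E \<omega> * P t \<omega> $ a\<close> is measurable for
  \<open>dec_sigma t\<close>, the remaining conditional expectation integrates away.\<close>

lemma integral_action_indicator:
  assumes t: "t \<ge> 1" and E: "E \<in> sets (dec_sigma t)" and B: "B \<in> sets borel"
  shows "(\<integral>\<omega>. indicator E \<omega> * (indicator {a} (A t \<omega>) * indicator B (Y t \<omega>)) \<partial>M) =
    (\<integral>\<omega>. indicator E \<omega> * P t \<omega> $ a * indicator B (Y t \<omega>) \<partial>M :: real)"
proof -
  let ?F = "dec_sigma t" and ?ce = "real_cond_exp M (dec_sigma t)"
  interpret F: finite_measure_subalgebra M ?F
    by unfold_locales (rule subalgebra_dec[OF t])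
  note A_measurable[OF t, measurable] Y_measurable[OF t, measurable] P_measurable[OF t, measurable]
  note P_dec[OF t, measurable] E[measurable] B[measurable]
  have [measurable]: "E \<in> sets M" using E F.subalg by (auto simp: subalgebra_def)
  have P1: "\<bar>P t \<omega> $ a\<bar> \<le> 1" if "\<omega> \<in> space M" for \<omega>
    using P_nonneg[OF t that] P_le_1[OF t that] by simp
  have "AE \<omega> in M. ?ce (\<lambda>\<omega>. indicator {a} (A t \<omega>)) \<omega> = P t \<omega> $ a"
    using bandit t by (simp add: contextual_bandit_def)
  moreover have "AE \<omega> in M. ?ce (\<lambda>\<omega>. indicator {a} (A t \<omega>) * indicator B (Y t \<omega>)) \<omega> =
      ?ce (\<lambda>\<omega>. indicator {a} (A t \<omega>)) \<omega> * ?ce (\<lambda>\<omega>. indicator B (Y t \<omega>)) \<omega>"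
    using unconfounded[OF t] B unfolding cond_indep_var_def
    by (elim conjE) (drule bspec[of _ _ "{a}"], simp, drule bspec[of _ _ B], assumption, assumption)
  ultimately have ce: "AE \<omega> in M. ?ce (\<lambda>\<omega>. indicator {a} (A t \<omega>) * indicator B (Y t \<omega>)) \<omega> =
      P t \<omega> $ a * ?ce (\<lambda>\<omega>. indicator B (Y t \<omega>)) \<omega>"
    by eventually_elim simp
  have "(\<integral>\<omega>. indicator E \<omega> * (indicator {a} (A t \<omega>) * indicator B (Y t \<omega>)) \<partial>M)
      = (\<integral>\<omega>. indicator E \<omega> * ?ce (\<lambda>\<omega>. indicator {a} (A t \<omega>) * indicator B (Y t \<omega>)) \<omega> \<partial>M)"
    by (intro F.real_cond_exp_intg(2)[symmetric] integrable_const_bound[where B=1])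
      (auto simp: indicator_def)
  also have "\<dots> = (\<integral>\<omega>. (indicator E \<omega> * P t \<omega> $ a) * ?ce (\<lambda>\<omega>. indicator B (Y t \<omega>)) \<omega> \<partial>M)"
  proof (rule integral_cong_AE)
    show "AE \<omega> in M. indicator E \<omega> * ?ce (\<lambda>\<omega>. indicator {a} (A t \<omega>) * indicator B (Y t \<omega>)) \<omega> =
        indicator E \<omega> * P t \<omega> $ a * ?ce (\<lambda>\<omega>. indicator B (Y t \<omega>)) \<omega>"
      using ce by eventually_elim (simp only: mult.assoc)
  qed measurable
  also have "\<dots> = (\<integral>\<omega>. (indicator E \<omega> * P t \<omega> $ a) * indicator B (Y t \<omega>) \<partial>M)"
    using P1 by (intro F.real_cond_exp_intg(2) integrable_const_bound[where B=1])
      (auto simp: indicator_def)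
  finally show ?thesis .
qed

text \<open>The first component maps \<open>\<omega>\<close> to itself, but into the smaller \<open>\<sigma>\<close>-algebra of \<open>(H\<^sub>t\<^sub>-\<^sub>1, X\<^sub>t)\<close>:
  it stands for these two variables.\<close>

lemma distr_action_propensity:
  assumes t: "t \<ge> 1"
  shows "distr (density M (\<lambda>\<omega>. ennreal (indicator {a} (A t \<omega>)))) (dec_sigma t \<Otimes>\<^sub>M borel) (\<lambda>\<omega>. (\<omega>, Y t \<omega>)) =
    distr (density M (\<lambda>\<omega>. ennreal (P t \<omega> $ a))) (dec_sigma t \<Otimes>\<^sub>M borel) (\<lambda>\<omega>. (\<omega>, Y t \<omega>))"
    (is "?L = ?R")
proof -
  note A_measurable[OF t, measurable] Y_measurable[OF t, measurable] P_measurable[OF t, measurable]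
  have sub: "subalgebra M (dec_sigma t)" by (rule subalgebra_dec[OF t])
  have [measurable]: "(\<lambda>\<omega>. \<omega>) \<in> measurable M (dec_sigma t)"
    using sub by (intro measurable_from_subalg[OF sub]) auto
  \<comment> \<open>Indicator and propensity both take values in [0, 1], so one computation
    evaluates both measures on rectangles and shows them finite.\<close>
  have eq: "emeasure (distr (density M (\<lambda>\<omega>. ennreal (w \<omega>))) (dec_sigma t \<Otimes>\<^sub>M borel) (\<lambda>\<omega>. (\<omega>, Y t \<omega>))) (E \<times> B)
      = ennreal (\<integral>\<omega>. indicator E \<omega> * (w \<omega> * indicator B (Y t \<omega>)) \<partial>M)"
    if [measurable]: "w \<in> borel_measurable M" and w: "\<And>\<omega>. \<omega> \<in> space M \<Longrightarrow> 0 \<le> w \<omega> \<and> w \<omega> \<le> 1"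
      and E: "E \<in> sets (dec_sigma t)" and [measurable]: "B \<in> sets borel" for w :: "'w \<Rightarrow> real" and E B
  proof -
    note E[measurable]
    have [measurable]: "E \<in> sets M" using E sub by (auto simp: subalgebra_def)
    have "emeasure (distr (density M (\<lambda>\<omega>. ennreal (w \<omega>))) (dec_sigma t \<Otimes>\<^sub>M borel) (\<lambda>\<omega>. (\<omega>, Y t \<omega>))) (E \<times> B)
      = emeasure (density M (\<lambda>\<omega>. ennreal (w \<omega>))) (E \<inter> (Y t -` B \<inter> space M))"
      by (subst emeasure_distr) (auto intro!: arg_cong2[where f=emeasure] dest: sets.sets_into_space)
    also have "\<dots> = (\<integral>\<^sup>+\<omega>. ennreal (indicator E \<omega> * (w \<omega> * indicator B (Y t \<omega>))) \<partial>M)"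
      by (subst emeasure_density) (auto intro!: nn_integral_cong simp: indicator_def)
    also have "\<dots> = ennreal (\<integral>\<omega>. indicator E \<omega> * (w \<omega> * indicator B (Y t \<omega>)) \<partial>M)"
      using w by (intro nn_integral_eq_integral integrable_const_bound[where B=1]) (auto simp: indicator_def)
    finally show ?thesis .
  qed
  have P01: "0 \<le> P t \<omega> $ a \<and> P t \<omega> $ a \<le> 1" if "\<omega> \<in> space M" for \<omega>
    using P_nonneg[OF t that] P_le_1[OF t that] by simp
  let ?E = "{E \<times> B |E B. E \<in> sets (dec_sigma t) \<and> B \<in> sets (borel :: (real^'k) measure)}"
  show ?thesis
  proof (rule measure_eqI_generator_eq[where E = ?E and \<Omega> = "space M \<times> UNIV" and A = "\<lambda>_. space M \<times> UNIV"])
    show "Int_stable ?E" by (rule Int_stable_pair_measure_generator)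
    show "?E \<subseteq> Pow (space M \<times> UNIV)"
      using sets.sets_into_space[of _ "dec_sigma t"] by auto
    show "sets ?L = sigma_sets (space M \<times> UNIV) ?E" "sets ?R = sigma_sets (space M \<times> UNIV) ?E"
      unfolding sets_distr sets_pair_measure space_dec space_borel by (rule refl)+
    have top: "space M \<in> sets (dec_sigma t)"
      using sets.top[of "dec_sigma t"] by simp
    then show "range (\<lambda>_. space M \<times> UNIV) \<subseteq> ?E"
      by (intro subsetI CollectI exI[of _ "space M"] exI[of _ UNIV]) auto
    show "emeasure ?L (space M \<times> UNIV) \<noteq> \<infinity>" for i :: nat
      using eq[of "\<lambda>\<omega>. indicator {a} (A t \<omega>)", OF _ _ top, of UNIV] by (simp add: indicator_def)
    show "(\<Union>i::nat. space M \<times> UNIV) = space M \<times> UNIV" by simp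
    fix Z assume "Z \<in> ?E"
    then obtain E B where Z: "Z = E \<times> B" "E \<in> sets (dec_sigma t)" "B \<in> sets borel" by auto
    have "emeasure ?L Z = ennreal (\<integral>\<omega>. indicator E \<omega> * (indicator {a} (A t \<omega>) * indicator B (Y t \<omega>)) \<partial>M)"
      unfolding Z(1) by (rule eq[OF _ _ Z(2,3)]) (auto simp: indicator_def)
    also have "\<dots> = ennreal (\<integral>\<omega>. indicator E \<omega> * (P t \<omega> $ a * indicator B (Y t \<omega>)) \<partial>M)"
      using integral_action_indicator[OF t Z(2,3), of a] by (simp only: mult.assoc)
    also have "\<dots> = emeasure ?R Z"
      unfolding Z(1) using P01 by (intro eq[OF _ _ Z(2,3), symmetric]) auto
    finally show "emeasure ?L Z = emeasure ?R Z" .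
  qed
qed

text \<open>Equal measures integrate alike: the identity for rectangles now holds for every real
  integrand in past, context and potential outcomes, and integrability transfers along with the
  value.\<close>

lemma
  fixes f :: "'w \<times> (real^'k) \<Rightarrow> real"
  assumes t: "t \<ge> 1" and f: "f \<in> borel_measurable (dec_sigma t \<Otimes>\<^sub>M borel)"
  shows integrable_action_propensity: "integrable M (\<lambda>\<omega>. indicator {a} (A t \<omega>) * f (\<omega>, Y t \<omega>)) \<longleftrightarrow>
      integrable M (\<lambda>\<omega>. P t \<omega> $ a * f (\<omega>, Y t \<omega>))"
    and integral_action_propensity: "(\<integral>\<omega>. indicator {a} (A t \<omega>) * f (\<omega>, Y t \<omega>) \<partial>M) =
      (\<integral>\<omega>. P t \<omega> $ a * f (\<omega>, Y t \<omega>) \<partial>M)"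
proof -
  note A_measurable[OF t, measurable] Y_measurable[OF t, measurable] P_measurable[OF t, measurable] f[measurable]
  have sub: "subalgebra M (dec_sigma t)" by (rule subalgebra_dec[OF t])
  have [measurable]: "(\<lambda>\<omega>. \<omega>) \<in> measurable M (dec_sigma t)"
    using sub by (intro measurable_from_subalg[OF sub]) auto
  have *: "integrable M (\<lambda>\<omega>. w \<omega> * f (\<omega>, Y t \<omega>)) \<longleftrightarrow>
      integrable (distr (density M (\<lambda>\<omega>. ennreal (w \<omega>))) (dec_sigma t \<Otimes>\<^sub>M borel) (\<lambda>\<omega>. (\<omega>, Y t \<omega>))) f"
    "(\<integral>\<omega>. w \<omega> * f (\<omega>, Y t \<omega>) \<partial>M) =
      (\<integral>z. f z \<partial>distr (density M (\<lambda>\<omega>. ennreal (w \<omega>))) (dec_sigma t \<Otimes>\<^sub>M borel) (\<lambda>\<omega>. (\<omega>, Y t \<omega>)))"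
    if [measurable]: "w \<in> borel_measurable M" and w: "\<And>\<omega>. \<omega> \<in> space M \<Longrightarrow> 0 \<le> w \<omega>" for w :: "'w \<Rightarrow> real"
    using w by (auto simp: integrable_distr_eq integral_distr integrable_density integral_density)
  show "integrable M (\<lambda>\<omega>. indicator {a} (A t \<omega>) * f (\<omega>, Y t \<omega>)) \<longleftrightarrow>
      integrable M (\<lambda>\<omega>. P t \<omega> $ a * f (\<omega>, Y t \<omega>))"
    "(\<integral>\<omega>. indicator {a} (A t \<omega>) * f (\<omega>, Y t \<omega>) \<partial>M) = (\<integral>\<omega>. P t \<omega> $ a * f (\<omega>, Y t \<omega>) \<partial>M)"
    using *[of "\<lambda>\<omega>. indicator {a} (A t \<omega>)"] *[of "\<lambda>\<omega>. P t \<omega> $ a"]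
      P_nonneg[OF t] distr_action_propensity[OF t, of a] by auto
qed

text \<open>The trade of the action indicator for the propensity cancels the division by
  \<open>P t \<omega> $ a\<close>, and independence of the past factors what is left. With
  \<open>U\<close> a sum of earlier centred terms this is the martingale orthogonality.\<close>

lemma
  fixes U :: "'w \<Rightarrow> real" and h :: "(real^'x) \<times> real \<Rightarrow> real"
  assumes t: "t \<ge> 1"
    and U: "U \<in> borel_measurable (hist_sigma (t - 1))" "integrable M U"
    and h: "h \<in> borel_measurable (ctx_space \<Otimes>\<^sub>M borel)" "integrable M (\<lambda>\<omega>. h (X t \<omega>, Y t \<omega> $ a))"
  shows integrable_past_times_ipw: "integrable M (\<lambda>\<omega>. U \<omega> * ipw a h t \<omega>)"
    and integral_past_times_ipw:
      "(\<integral>\<omega>. U \<omega> * ipw a h t \<omega> \<partial>M) = (\<integral>\<omega>. U \<omega> \<partial>M) * (\<integral>\<omega>. h (X t \<omega>, Y t \<omega> $ a) \<partial>M)"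
proof -
  note A_measurable[OF t, measurable] Y_measurable[OF t, measurable] P_measurable[OF t, measurable]
    P_dec[OF t, measurable] X_dec[OF t, measurable] X_ctx[OF t, measurable] h(1)[measurable]
  have [measurable]: "U \<in> borel_measurable (dec_sigma t)" "U \<in> borel_measurable M"
    using U(1) measurable_from_subalg[OF subalgebra_dec_hist[OF t]] measurable_from_subalg[OF subalgebra_hist] by auto
  \<comment> \<open>Past factor, context and propensity all depend on \<open>\<omega>\<close>
    through \<open>dec_sigma t\<close> alone; only the outcome vector sits in the second
    coordinate.\<close>
  define f where "f = (\<lambda>(\<omega>, y). U \<omega> * h (X t \<omega>, y $ a) / P t \<omega> $ a)"
  have f: "f \<in> borel_measurable (dec_sigma t \<Otimes>\<^sub>M borel)"
    unfolding f_def by measurable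
  have ipw: "U \<omega> * ipw a h t \<omega> = indicator {a} (A t \<omega>) * f (\<omega>, Y t \<omega>)" for \<omega>
    by (simp add: ipw_eq f_def)
  \<comment> \<open>The cancellation needs a nonzero propensity, which overlap grants only almost
    everywhere.\<close>
  have AE: "AE \<omega> in M. P t \<omega> $ a * f (\<omega>, Y t \<omega>) = U \<omega> * h (X t \<omega>, Y t \<omega> $ a)"
    using overlap[OF t, of a]
  proof eventually_elim
    case (elim \<omega>)
    then have "P t \<omega> $ a \<noteq> 0" using \<pi>min by linarith
    then show ?case by (simp add: f_def)
  qed
  have m: "(\<lambda>\<omega>. P t \<omega> $ a * f (\<omega>, Y t \<omega>)) \<in> borel_measurable M"
    unfolding f_def by measurable
  have m': "(\<lambda>\<omega>. U \<omega> * h (X t \<omega>, Y t \<omega> $ a)) \<in> borel_measurable M"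
    by measurable
  show "integrable M (\<lambda>\<omega>. U \<omega> * ipw a h t \<omega>)"
    using integrable_past_times_outcome[OF t U h] integrable_cong_AE[OF m m' AE]
    by (simp add: ipw integrable_action_propensity[OF t f])
  show "(\<integral>\<omega>. U \<omega> * ipw a h t \<omega> \<partial>M) = (\<integral>\<omega>. U \<omega> \<partial>M) * (\<integral>\<omega>. h (X t \<omega>, Y t \<omega> $ a) \<partial>M)"
    using integral_past_times_outcome[OF t U h] integral_cong_AE[OF m m' AE]
    by (simp add: ipw integral_action_propensity[OF t f])
qed

end

section \<open>Law of large numbers for weighted averages at a fixed parameter\<close>

context ipw_bandit
begin

lemma ipw_bound:
  fixes f :: "(real^'x) \<times> real \<Rightarrow> 'b::real_normed_vector"
  assumes t: "t \<ge> 1"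
  shows "AE \<omega> in M. norm (ipw a f t \<omega>) \<le> norm (f (X t \<omega>, Y t \<omega> $ a)) / \<pi>min"
  using overlap[OF t, of a]
proof eventually_elim
  case (elim \<omega>)
  have "norm (ipw a f t \<omega>) \<le> 1 / P t \<omega> $ a * norm (f (X t \<omega>, Y t \<omega> $ a))"
    using elim \<pi>min by (auto simp: ipw_eq indicator_def)
  also have "\<dots> \<le> 1 / \<pi>min * norm (f (X t \<omega>, Y t \<omega> $ a))"
    using elim \<pi>min by (intro mult_right_mono divide_left_mono) auto
  finally show ?case by simp
qed

lemma integrable_ipw:
  fixes f :: "(real^'x) \<times> real \<Rightarrow> 'b::{banach, second_countable_topology}"
  assumes t: "t \<ge> 1" and f: "f \<in> borel_measurable (ctx_space \<Otimes>\<^sub>M borel)"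
    and int: "integrable M (\<lambda>\<omega>. f (X 1 \<omega>, Y 1 \<omega> $ a))"
  shows "integrable M (ipw a f t)"
proof (rule Bochner_Integration.integrable_bound)
  show "integrable M (\<lambda>\<omega>. norm (f (X t \<omega>, Y t \<omega> $ a)) / \<pi>min)"
    using integrable_outcome[OF t f] int by (intro integrable_divide_zero integrable_norm) auto
  show "AE \<omega> in M. norm (ipw a f t \<omega>) \<le> norm (norm (f (X t \<omega>, Y t \<omega> $ a)) / \<pi>min)"
    using ipw_bound[OF t, of a f] \<pi>min by simp
qed (rule ipw_measurable[OF t f])

text \<open>Orthogonal increments: the cross terms vanish, so the second moment of the sum is at
  most \<open>n\<close> times a bound for one term. \<open>C\<close> is that bound, from a weight of
  at most \<open>1 / \<pi>min\<close> and the inequality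
  \<open>(u - m)\<^sup>2 \<le> 2 * u\<^sup>2 + 2 * m\<^sup>2\<close>.\<close>

lemma
  fixes h :: "(real^'x) \<times> real \<Rightarrow> real"
  assumes h: "h \<in> borel_measurable (ctx_space \<Otimes>\<^sub>M borel)"
    and sq: "integrable M (\<lambda>\<omega>. (h (X 1 \<omega>, Y 1 \<omega> $ a))\<^sup>2)"
  defines "m \<equiv> \<integral>\<omega>. h (X 1 \<omega>, Y 1 \<omega> $ a) \<partial>M"
    and "C \<equiv> 2 / \<pi>min\<^sup>2 * (\<integral>\<omega>. (h (X 1 \<omega>, Y 1 \<omega> $ a))\<^sup>2 \<partial>M) + 2 * (\<integral>\<omega>. h (X 1 \<omega>, Y 1 \<omega> $ a) \<partial>M)\<^sup>2"
  shows integrable_ipw_sum_square: "integrable M (\<lambda>\<omega>. (\<Sum>\<tau>=1..n. ipw a h \<tau> \<omega> - m)\<^sup>2)"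
    and integral_ipw_sum_square_le: "(\<integral>\<omega>. (\<Sum>\<tau>=1..n. ipw a h \<tau> \<omega> - m)\<^sup>2 \<partial>M) \<le> real n * C"
proof -
  have hsq: "(\<lambda>z. (h z)\<^sup>2) \<in> borel_measurable (ctx_space \<Otimes>\<^sub>M borel)"
    using h by measurable
  have int: "integrable M (\<lambda>\<omega>. h (X t \<omega>, Y t \<omega> $ a))" if "t \<ge> 1" for t
  proof -
    have "(\<lambda>\<omega>. h (X 1 \<omega>, Y 1 \<omega> $ a)) \<in> borel_measurable M"
      using measurable_compose[OF outcome_ctx h] by simp
    from square_integrable_imp_integrable[OF this sq] show ?thesis
      using integrable_outcome[OF that h] by simp
  qed
  define D where "D \<tau> \<omega> = ipw a h \<tau> \<omega> - m" for \<tau> \<omega>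
  have Dm: "D \<tau> \<in> borel_measurable M" if "\<tau> \<ge> 1" for \<tau>
    unfolding D_def using ipw_measurable[OF that h] by measurable
  have D_int: "integrable M (D \<tau>)" if "\<tau> \<ge> 1" for \<tau>
    unfolding D_def using integrable_ipw[OF that h int] by simp
  have D: "integrable M (\<lambda>\<omega>. (D \<tau> \<omega>)\<^sup>2) \<and> (\<integral>\<omega>. (D \<tau> \<omega>)\<^sup>2 \<partial>M) \<le> C" if \<tau>: "\<tau> \<ge> 1" for \<tau>
  proof -
    let ?b = "\<lambda>\<omega>. 2 / \<pi>min\<^sup>2 * (h (X \<tau> \<omega>, Y \<tau> \<omega> $ a))\<^sup>2 + 2 * m\<^sup>2"
    have b: "integrable M ?b" "(\<integral>\<omega>. ?b \<omega> \<partial>M) = C"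
      using sq integrable_outcome[OF \<tau> hsq, of a] integral_outcome[OF \<tau> hsq, of a]
      by (simp_all add: C_def m_def prob_space)
    have AE: "AE \<omega> in M. (D \<tau> \<omega>)\<^sup>2 \<le> ?b \<omega>"
      using ipw_bound[OF \<tau>, of a h]
    proof eventually_elim
      case (elim \<omega>)
      then have "(ipw a h \<tau> \<omega>)\<^sup>2 \<le> (\<bar>h (X \<tau> \<omega>, Y \<tau> \<omega> $ a)\<bar> / \<pi>min)\<^sup>2"
        using \<pi>min by (intro abs_le_square_iff[THEN iffD1]) simp
      \<comment> \<open>The difference of the two sides is the square of
        \<open>ipw a h \<tau> \<omega> + m\<close>.\<close>
      moreover have "(D \<tau> \<omega>)\<^sup>2 \<le> 2 * (ipw a h \<tau> \<omega>)\<^sup>2 + 2 * m\<^sup>2"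
        using zero_le_power2[of "ipw a h \<tau> \<omega> + m"] by (simp add: D_def power2_eq_square algebra_simps)
      ultimately show ?case by (simp add: power_divide)
    qed
    have int_D: "integrable M (\<lambda>\<omega>. (D \<tau> \<omega>)\<^sup>2)"
    proof (rule Bochner_Integration.integrable_bound[OF b(1)])
      show "(\<lambda>\<omega>. (D \<tau> \<omega>)\<^sup>2) \<in> borel_measurable M" using Dm[OF \<tau>] by measurable
      show "AE \<omega> in M. norm ((D \<tau> \<omega>)\<^sup>2) \<le> norm (?b \<omega>)"
        using AE
      proof eventually_elim
        case (elim \<omega>)
        show ?case
          using order_trans[OF elim abs_ge_self] by (simp only: real_norm_def abs_power2)
      qed
    qed
    show ?thesis
      using integral_mono_AE[OF int_D b(1) AE] int_D unfolding b(2) by (rule conjI[rotated])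
  qed
  have "integrable M (\<lambda>\<omega>. (\<Sum>\<tau>=1..n. D \<tau> \<omega>)\<^sup>2) \<and> (\<integral>\<omega>. (\<Sum>\<tau>=1..n. D \<tau> \<omega>)\<^sup>2 \<partial>M) \<le> real n * C"
  proof (induction n)
    case 0
    then show ?case by simp
  next
    case (Suc n)
    define S where "S \<omega> = (\<Sum>\<tau>=1..n. D \<tau> \<omega>)" for \<omega>
    have S: "S \<in> borel_measurable (hist_sigma (Suc n - 1))"
      unfolding S_def D_def using ipw_hist[OF _ _ h] by (intro borel_measurable_sum borel_measurable_diff) auto
    have S_int: "integrable M S"
      unfolding S_def using D_int by (intro Bochner_Integration.integrable_sum) auto
    note past = integrable_past_times_ipw[OF _ S S_int h int] integral_past_times_ipw[OF _ S S_int h int]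
    have SD: "S \<omega> * D (Suc n) \<omega> = S \<omega> * ipw a h (Suc n) \<omega> - S \<omega> * m" for \<omega>
      by (simp add: D_def algebra_simps)
    have SD_int: "integrable M (\<lambda>\<omega>. S \<omega> * D (Suc n) \<omega>)"
      unfolding SD using past(1) S_int by (intro Bochner_Integration.integrable_diff) auto
    \<comment> \<open>\<open>S\<close> is measurable for the past of time \<open>Suc n\<close>, so
      the weighted term contributes \<open>m\<close> times the expectation of \<open>S\<close>,
      exactly what centring subtracts.\<close>
    have SD_0: "(\<integral>\<omega>. S \<omega> * D (Suc n) \<omega> \<partial>M) = 0"
      unfolding SD using past S_int integral_outcome[OF _ h, of "Suc n" a]
      by (subst Bochner_Integration.integral_diff) (auto simp: m_def)
    have sum: "(\<Sum>\<tau>=1..Suc n. D \<tau> \<omega>)\<^sup>2 = (S \<omega>)\<^sup>2 + 2 * (S \<omega> * D (Suc n) \<omega>) + (D (Suc n) \<omega>)\<^sup>2" for \<omega>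
      by (simp add: S_def power2_eq_square algebra_simps)
    have IH: "integrable M (\<lambda>\<omega>. (S \<omega>)\<^sup>2)" "(\<integral>\<omega>. (S \<omega>)\<^sup>2 \<partial>M) \<le> real n * C"
      using Suc by (auto simp: S_def)
    have D': "integrable M (\<lambda>\<omega>. (D (Suc n) \<omega>)\<^sup>2)" "(\<integral>\<omega>. (D (Suc n) \<omega>)\<^sup>2 \<partial>M) \<le> C"
      using D[of "Suc n"] by auto
    show ?case
      unfolding sum of_nat_Suc distrib_right mult_1 using IH D' SD_int SD_0 by simp
  qed
  then show "integrable M (\<lambda>\<omega>. (\<Sum>\<tau>=1..n. ipw a h \<tau> \<omega> - m)\<^sup>2)"
    "(\<integral>\<omega>. (\<Sum>\<tau>=1..n. ipw a h \<tau> \<omega> - m)\<^sup>2 \<partial>M) \<le> real n * C"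
    by (simp_all add: D_def)
qed

text \<open>Dividing the linear bound by the squared sample size and taking the root gives the rate
  \<open>sqrt (C / real n)\<close>.\<close>

lemma ipw_mean_L1_real:
  fixes h :: "(real^'x) \<times> real \<Rightarrow> real"
  assumes h: "h \<in> borel_measurable (ctx_space \<Otimes>\<^sub>M borel)"
    and sq: "integrable M (\<lambda>\<omega>. (h (X 1 \<omega>, Y 1 \<omega> $ a))\<^sup>2)"
  shows "(\<lambda>n. \<integral>\<omega>. \<bar>(1 / real n) * (\<Sum>\<tau>=1..n. ipw a h \<tau> \<omega>) - (\<integral>\<omega>. h (X 1 \<omega>, Y 1 \<omega> $ a) \<partial>M)\<bar> \<partial>M) \<longlonglongrightarrow> 0"
proof -
  define m where "m = (\<integral>\<omega>. h (X 1 \<omega>, Y 1 \<omega> $ a) \<partial>M)"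
  define C where "C = 2 / \<pi>min\<^sup>2 * (\<integral>\<omega>. (h (X 1 \<omega>, Y 1 \<omega> $ a))\<^sup>2 \<partial>M) + 2 * m\<^sup>2"
  note sum_sq = integrable_ipw_sum_square[OF h sq, folded m_def]
    integral_ipw_sum_square_le[OF h sq, folded m_def, folded C_def]
  have le: "(\<integral>\<omega>. \<bar>(1 / real n) * (\<Sum>\<tau>=1..n. ipw a h \<tau> \<omega>) - m\<bar> \<partial>M) \<le> sqrt (C / real n)" if n: "n \<ge> 1" for n
  proof -
    let ?Z = "\<lambda>\<omega>. (1 / real n) * (\<Sum>\<tau>=1..n. ipw a h \<tau> \<omega>) - m"
    have Z: "?Z \<omega> = (1 / real n) * (\<Sum>\<tau>=1..n. ipw a h \<tau> \<omega> - m)" for \<omega>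
      using n by (simp add: sum_subtractf right_diff_distrib)
    have Z2: "(?Z \<omega>)\<^sup>2 = (1 / real n)\<^sup>2 * (\<Sum>\<tau>=1..n. ipw a h \<tau> \<omega> - m)\<^sup>2" for \<omega>
      unfolding Z by (simp only: power_mult_distrib)
    have "(\<integral>\<omega>. \<bar>?Z \<omega>\<bar> \<partial>M) \<le> sqrt (\<integral>\<omega>. (?Z \<omega>)\<^sup>2 \<partial>M)"
    proof (rule expectation_abs_le_sqrt)
      show "?Z \<in> borel_measurable M"
        using ipw_measurable[OF _ h]
        by (intro borel_measurable_diff borel_measurable_times borel_measurable_sum) auto
      show "integrable M (\<lambda>\<omega>. (?Z \<omega>)\<^sup>2)"
        unfolding Z2 by (intro integrable_mult_right sum_sq(1))
    qed
    also have "(\<integral>\<omega>. (?Z \<omega>)\<^sup>2 \<partial>M) = (1 / real n)\<^sup>2 * (\<integral>\<omega>. (\<Sum>\<tau>=1..n. ipw a h \<tau> \<omega> - m)\<^sup>2 \<partial>M)"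
      unfolding Z2 by simp
    also have "\<dots> \<le> (1 / real n)\<^sup>2 * (real n * C)"
      by (intro mult_left_mono sum_sq(2)) simp
    also have "\<dots> = C / real n"
      using n by (simp add: power2_eq_square)
    finally show ?thesis by simp
  qed
  have "(\<lambda>n. sqrt (C / real n)) \<longlonglongrightarrow> sqrt 0"
    by (intro tendsto_real_sqrt lim_const_over_n)
  then have lim: "(\<lambda>n. sqrt (C / real n)) \<longlonglongrightarrow> 0" by simp
  show ?thesis
    unfolding m_def[symmetric]
  proof (rule Lim_null_comparison[OF _ lim])
    show "\<forall>\<^sub>F n in sequentially. norm (\<integral>\<omega>. \<bar>(1 / real n) * (\<Sum>\<tau>=1..n. ipw a h \<tau> \<omega>) - m\<bar> \<partial>M) \<le> sqrt (C / real n)"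
      using eventually_ge_at_top[of "1::nat"]
    proof eventually_elim
      case (elim n)
      have "0 \<le> (\<integral>\<omega>. \<bar>(1 / real n) * (\<Sum>\<tau>=1..n. ipw a h \<tau> \<omega>) - m\<bar> \<partial>M)"
        by (rule integral_nonneg_AE) simp
      then show ?case
        using le[OF elim] unfolding real_norm_def by linarith
    qed
  qed
qed

lemma ipw_component: "(ipw a f t \<omega>) $ i = ipw a (\<lambda>z. f z $ i) t \<omega>"
  by (simp add: ipw_def)

text \<open>Reduces to the scalar case coordinate by coordinate, since the norm is at most the sum
  of the absolute coordinates.\<close>

lemma ipw_mean_L1:
  fixes f :: "(real^'x) \<times> real \<Rightarrow> real^'d"
  assumes f: "f \<in> borel_measurable (ctx_space \<Otimes>\<^sub>M borel)"
    and sq: "integrable M (\<lambda>\<omega>. (norm (f (X 1 \<omega>, Y 1 \<omega> $ a)))\<^sup>2)"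
  shows "integrable M (\<lambda>\<omega>. f (X 1 \<omega>, Y 1 \<omega> $ a))"
    and "(\<lambda>n. \<integral>\<omega>. norm ((1 / real n) *\<^sub>R (\<Sum>\<tau>=1..n. ipw a f \<tau> \<omega>) - (\<integral>\<omega>. f (X 1 \<omega>, Y 1 \<omega> $ a) \<partial>M)) \<partial>M) \<longlonglongrightarrow> 0"
proof -
  have fm: "(\<lambda>\<omega>. f (X 1 \<omega>, Y 1 \<omega> $ a)) \<in> borel_measurable M"
    by (rule measurable_compose[OF outcome_ctx f]) simp
  show int: "integrable M (\<lambda>\<omega>. f (X 1 \<omega>, Y 1 \<omega> $ a))"
    using square_integrable_imp_integrable[of "\<lambda>\<omega>. norm (f (X 1 \<omega>, Y 1 \<omega> $ a))"] sq fm
    by (simp add: integrable_norm_iff)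
  define m where "m = (\<integral>\<omega>. f (X 1 \<omega>, Y 1 \<omega> $ a) \<partial>M)"
  have mi: "m $ i = (\<integral>\<omega>. f (X 1 \<omega>, Y 1 \<omega> $ a) $ i \<partial>M)" for i
    unfolding m_def using integral_bounded_linear[OF bounded_linear_vec_nth int] by simp
  have fi: "(\<lambda>z. f z $ i) \<in> borel_measurable (ctx_space \<Otimes>\<^sub>M borel)" for i
    by (rule measurable_compose[OF f borel_measurable_vec_nth])
  have sqi: "integrable M (\<lambda>\<omega>. (f (X 1 \<omega>, Y 1 \<omega> $ a) $ i)\<^sup>2)" for i
  proof (rule Bochner_Integration.integrable_bound[OF sq])
    show "(\<lambda>\<omega>. (f (X 1 \<omega>, Y 1 \<omega> $ a) $ i)\<^sup>2) \<in> borel_measurable M"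
      using measurable_compose[OF fm borel_measurable_vec_nth] by measurable
    show "AE \<omega> in M. norm ((f (X 1 \<omega>, Y 1 \<omega> $ a) $ i)\<^sup>2) \<le> norm ((norm (f (X 1 \<omega>, Y 1 \<omega> $ a)))\<^sup>2)"
      using component_le_norm_cart[of _ i] by (auto simp: abs_le_square_iff[symmetric])
  qed
  let ?Z = "\<lambda>n \<omega>. (1 / real n) *\<^sub>R (\<Sum>\<tau>=1..n. ipw a f \<tau> \<omega>) - m"
  let ?Zi = "\<lambda>i n \<omega>. (1 / real n) * (\<Sum>\<tau>=1..n. ipw a (\<lambda>z. f z $ i) \<tau> \<omega>) - m $ i"
  have lim: "(\<lambda>n. \<Sum>i\<in>UNIV. \<integral>\<omega>. \<bar>?Zi i n \<omega>\<bar> \<partial>M) \<longlonglongrightarrow> (\<Sum>i\<in>(UNIV::'d set). 0)"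
    unfolding mi by (intro tendsto_sum ipw_mean_L1_real fi sqi)
  have Z_int: "integrable M (?Z n)" for n
    using integrable_ipw[OF _ f int]
    by (intro Bochner_Integration.integrable_diff integrable_scaleR_right Bochner_Integration.integrable_sum) auto
  have Zi: "?Z n \<omega> $ i = ?Zi i n \<omega>" for i n \<omega>
    by (simp add: ipw_component)
  have Zi_int: "integrable M (?Zi i n)" for i n
    unfolding Zi[symmetric] by (rule integrable_bounded_linear[OF bounded_linear_vec_nth Z_int])
  have le: "(\<integral>\<omega>. norm (?Z n \<omega>) \<partial>M) \<le> (\<Sum>i\<in>UNIV. \<integral>\<omega>. \<bar>?Zi i n \<omega>\<bar> \<partial>M)" for n
  proof -
    have "(\<integral>\<omega>. norm (?Z n \<omega>) \<partial>M) \<le> (\<integral>\<omega>. (\<Sum>i\<in>UNIV. \<bar>?Zi i n \<omega>\<bar>) \<partial>M)"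
    proof (rule integral_mono)
      show "norm (?Z n \<omega>) \<le> (\<Sum>i\<in>UNIV. \<bar>?Zi i n \<omega>\<bar>)" for \<omega>
        using norm_le_l1_cart[of "?Z n \<omega>"] unfolding Zi .
    qed (intro integrable_norm Z_int Bochner_Integration.integrable_sum integrable_abs Zi_int)+
    also have "\<dots> = (\<Sum>i\<in>UNIV. \<integral>\<omega>. \<bar>?Zi i n \<omega>\<bar> \<partial>M)"
      by (intro Bochner_Integration.integral_sum integrable_abs Zi_int)
    finally show ?thesis .
  qed
  show "(\<lambda>n. \<integral>\<omega>. norm ((1 / real n) *\<^sub>R (\<Sum>\<tau>=1..n. ipw a f \<tau> \<omega>) - (\<integral>\<omega>. f (X 1 \<omega>, Y 1 \<omega> $ a) \<partial>M)) \<partial>M) \<longlonglongrightarrow> 0"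
    unfolding m_def[symmetric]
  proof (rule Lim_null_comparison)
    show "(\<lambda>n. \<Sum>i\<in>UNIV. \<integral>\<omega>. \<bar>?Zi i n \<omega>\<bar> \<partial>M) \<longlonglongrightarrow> 0"
      using lim unfolding sum.neutral_const .
    have "0 \<le> (\<integral>\<omega>. norm (?Z n \<omega>) \<partial>M)" for n
      by (rule integral_nonneg_AE) simp
    then show "\<forall>\<^sub>F n in sequentially. norm (\<integral>\<omega>. norm (?Z n \<omega>) \<partial>M) \<le> (\<Sum>i\<in>UNIV. \<integral>\<omega>. \<bar>?Zi i n \<omega>\<bar> \<partial>M)"
      using le by (intro always_eventually allI) (simp only: real_norm_def abs_of_nonneg)
  qed
qed

section \<open>Consistency of estimators that nearly solve the weighted score equation\<close>

lemma ipw_average_measurable: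
  fixes g :: "(real^'x) \<times> real \<Rightarrow> real^'d \<Rightarrow> real^'d"
  assumes gm: "\<And>\<theta>. (\<lambda>z. g z \<theta>) \<in> borel_measurable (ctx_space \<Otimes>\<^sub>M borel)"
    and cont: "\<And>z. z \<in> \<X> \<times> UNIV \<Longrightarrow> continuous_on UNIV (g z)"
    and T: "T \<in> borel_measurable M"
  shows "(\<lambda>\<omega>. (1 / real t) *\<^sub>R (\<Sum>\<tau>=1..t. ipw a (\<lambda>z. g z (T \<omega>)) \<tau> \<omega>)) \<in> borel_measurable M"
\<comment> \<open>For fixed \<open>\<omega>\<close> the average is continuous in the parameter, so a
  random parameter may be inserted whatever its dependence on the sample.\<close>
proof (rule borel_measurable_caratheodory[OF _ _ T, where f = "\<lambda>\<omega> \<theta>. (1 / real t) *\<^sub>R (\<Sum>\<tau>=1..t. ipw a (\<lambda>z. g z \<theta>) \<tau> \<omega>)"])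
  show "(\<lambda>\<omega>. (1 / real t) *\<^sub>R (\<Sum>\<tau>=1..t. ipw a (\<lambda>z. g z \<theta>) \<tau> \<omega>)) \<in> borel_measurable M" for \<theta>
    using ipw_measurable[OF _ gm] by (intro borel_measurable_scaleR borel_measurable_sum) auto
  show "continuous_on UNIV (\<lambda>\<theta>. (1 / real t) *\<^sub>R (\<Sum>\<tau>=1..t. ipw a (\<lambda>z. g z \<theta>) \<tau> \<omega>))" if "\<omega> \<in> space M" for \<omega>
    unfolding ipw_def using X_in that by (intro continuous_intros cont) auto
qed

text \<open>Where the estimate is \<open>\<epsilon>\<close>-far from \<open>\<theta>\<^sub>0\<close>, the population score is at least \<open>\<eta>\<close> while the weighted
  sample score nearly vanishes. Their gap is bounded uniformly over \<open>\<Theta>\<close>: by the law of large numbers on a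
  finite net, and by the average of the Lipschitz constants between the net points.\<close>

lemma z_estimator_consistent:
  fixes g :: "(real^'x) \<times> real \<Rightarrow> real^'d \<Rightarrow> real^'d" and T :: "nat \<Rightarrow> 'w \<Rightarrow> real^'d"
  assumes gm: "\<And>\<theta>. (\<lambda>z. g z \<theta>) \<in> borel_measurable (ctx_space \<Otimes>\<^sub>M borel)"
    and cont: "\<And>z. z \<in> \<X> \<times> UNIV \<Longrightarrow> continuous_on UNIV (g z)"
    and \<Theta>: "compact \<Theta>"
    and lip: "\<And>z \<theta> \<theta>'. z \<in> \<X> \<times> UNIV \<Longrightarrow> \<theta> \<in> \<Theta> \<Longrightarrow> \<theta>' \<in> \<Theta> \<Longrightarrow> dist (g z \<theta>) (g z \<theta>') \<le> \<phi> z * dist \<theta> \<theta>'"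
    and \<phi>: "\<And>z. z \<in> \<X> \<times> UNIV \<Longrightarrow> 0 \<le> \<phi> z" "integrable M (\<lambda>\<omega>. (\<phi> (X 1 \<omega>, Y 1 \<omega> $ a))\<^sup>2)"
    and sq: "\<And>\<theta>. \<theta> \<in> \<Theta> \<Longrightarrow> integrable M (\<lambda>\<omega>. (norm (g (X 1 \<omega>, Y 1 \<omega> $ a) \<theta>))\<^sup>2)"
    and \<eta>: "\<eta> > 0" "\<And>\<theta>. \<theta> \<in> \<Theta> \<Longrightarrow> dist \<theta> \<theta>\<^sub>0 > \<epsilon> \<Longrightarrow> norm (\<integral>\<omega>. g (X 1 \<omega>, Y 1 \<omega> $ a) \<theta> \<partial>M) \<ge> \<eta>"
    and T: "\<And>t. T t \<in> borel_measurable M" "\<And>t \<omega>. \<omega> \<in> space M \<Longrightarrow> T t \<omega> \<in> \<Theta>"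
    and root: "converges_in_prob M (\<lambda>t \<omega>. (1 / real t) *\<^sub>R (\<Sum>\<tau>=1..t. ipw a (\<lambda>z. g z (T t \<omega>)) \<tau> \<omega>)) (\<lambda>_. 0)"
  shows "(\<lambda>t. prob {\<omega> \<in> space M. dist (T t \<omega>) \<theta>\<^sub>0 > \<epsilon>}) \<longlonglongrightarrow> 0"
proof -
  let ?N = "ctx_space \<Otimes>\<^sub>M (borel :: real measure)"
  have spN: "space ?N = \<X> \<times> UNIV"
    by (simp add: space_pair_measure space_restrict_space)
  \<comment> \<open>Moving an expectation to another time requires a measurable function, so
    \<open>\<l>\<close> takes the place of \<open>\<phi>\<close> and inherits square integrability
    from it.\<close>
  obtain \<l> where \<l>: "\<l> \<in> borel_measurable ?N" "\<And>z. z \<in> \<X> \<times> UNIV \<Longrightarrow> 0 \<le> \<l> z"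
      "\<And>z. z \<in> \<X> \<times> UNIV \<Longrightarrow> \<l> z \<le> \<phi> z"
      "\<And>z \<theta> \<theta>'. z \<in> \<X> \<times> UNIV \<Longrightarrow> \<theta> \<in> \<Theta> \<Longrightarrow> \<theta>' \<in> \<Theta> \<Longrightarrow> dist (g z \<theta>) (g z \<theta>') \<le> \<l> z * dist \<theta> \<theta>'"
    using measurable_lipschitz_constant[of g ?N \<Theta> \<phi>] gm lip \<phi>(1) unfolding spN by metis
  have z_in: "(X t \<omega>, y) \<in> \<X> \<times> UNIV" if "t \<ge> 1" "\<omega> \<in> space M" for t \<omega> y
    using X_in that by auto
  have \<l>_int1: "integrable M (\<lambda>\<omega>. \<l> (X 1 \<omega>, Y 1 \<omega> $ a))"
  proof (rule square_integrable_imp_integrable)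
    show "(\<lambda>\<omega>. \<l> (X 1 \<omega>, Y 1 \<omega> $ a)) \<in> borel_measurable M"
      by (rule measurable_compose[OF outcome_ctx \<l>(1)]) simp
    then show "integrable M (\<lambda>\<omega>. (\<l> (X 1 \<omega>, Y 1 \<omega> $ a))\<^sup>2)"
      by (intro Bochner_Integration.integrable_bound[OF \<phi>(2)] AE_I2)
        (auto intro!: power_mono \<l>(2,3) X_in)
  qed
  define E\<l> where "E\<l> = (\<integral>\<omega>. \<l> (X 1 \<omega>, Y 1 \<omega> $ a) \<partial>M)"
  have \<l>_int: "integrable M (\<lambda>\<omega>. \<l> (X t \<omega>, Y t \<omega> $ a))" "(\<integral>\<omega>. \<l> (X t \<omega>, Y t \<omega> $ a) \<partial>M) = E\<l>" if "t \<ge> 1" for t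
    using integrable_outcome[OF that \<l>(1)] integral_outcome[OF that \<l>(1)] \<l>_int1 by (simp_all add: E\<l>_def)
  have E\<l>: "E\<l> \<ge> 0"
    unfolding E\<l>_def using \<l>(2) z_in by (intro integral_nonneg_AE AE_I2) auto
  define G where "G \<theta> = (\<integral>\<omega>. g (X 1 \<omega>, Y 1 \<omega> $ a) \<theta> \<partial>M)" for \<theta>
  define S where "S t \<theta> \<omega> = (1 / real t) *\<^sub>R (\<Sum>\<tau>=1..t. ipw a (\<lambda>z. g z \<theta>) \<tau> \<omega>)" for t \<theta> \<omega>
  \<comment> \<open>Bounding each weight by \<open>1 / \<pi>min\<close> and dropping the action
    indicator leaves an average of identically distributed terms, whose mean
    \<open>E\<l> / \<pi>min\<close> is the same for every \<open>t \<ge> 1\<close>.\<close>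
  define Z where "Z t \<omega> = (1 / real t) * (\<Sum>\<tau>=1..t. \<l> (X \<tau> \<omega>, Y \<tau> \<omega> $ a) / \<pi>min)" for t \<omega>
  have g_int: "integrable M (\<lambda>\<omega>. g (X 1 \<omega>, Y 1 \<omega> $ a) \<theta>)"
    and S_lim: "(\<lambda>t. \<integral>\<omega>. norm (S t \<theta> \<omega> - G \<theta>) \<partial>M) \<longlonglongrightarrow> 0" if "\<theta> \<in> \<Theta>" for \<theta>
    using ipw_mean_L1[OF gm sq[OF that]] by (simp_all add: S_def G_def)
  have S_int: "integrable M (S t \<theta>)" if "\<theta> \<in> \<Theta>" for t \<theta>
    unfolding S_def using integrable_ipw[OF _ gm g_int[OF that]]
    by (intro integrable_scaleR_right Bochner_Integration.integrable_sum) auto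
  have Z_int: "integrable M (Z t)" for t
    unfolding Z_def using \<l>_int(1)
    by (intro integrable_mult_right Bochner_Integration.integrable_sum integrable_divide_zero) auto
  have EZ: "(\<integral>\<omega>. Z t \<omega> \<partial>M) = E\<l> / \<pi>min" if "t \<ge> 1" for t
    unfolding Z_def using \<l>_int that by (simp add: Bochner_Integration.integral_sum)
  have Z_nonneg: "0 \<le> Z t \<omega>" if "\<omega> \<in> space M" for t \<omega>
    unfolding Z_def using \<pi>min that \<l>(2) z_in by (intro mult_nonneg_nonneg sum_nonneg divide_nonneg_nonneg) auto
  have G_lip: "norm (G \<theta> - G \<theta>') \<le> E\<l> * dist \<theta> \<theta>'" if "\<theta> \<in> \<Theta>" "\<theta>' \<in> \<Theta>" for \<theta> \<theta>'
  proof -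
    have "norm (G \<theta> - G \<theta>') = norm (\<integral>\<omega>. g (X 1 \<omega>, Y 1 \<omega> $ a) \<theta> - g (X 1 \<omega>, Y 1 \<omega> $ a) \<theta>' \<partial>M)"
      unfolding G_def using g_int that by simp
    also have "\<dots> \<le> (\<integral>\<omega>. norm (g (X 1 \<omega>, Y 1 \<omega> $ a) \<theta> - g (X 1 \<omega>, Y 1 \<omega> $ a) \<theta>') \<partial>M)"
      by (rule integral_norm_bound)
    also have "\<dots> \<le> (\<integral>\<omega>. \<l> (X 1 \<omega>, Y 1 \<omega> $ a) * dist \<theta> \<theta>' \<partial>M)"
      using g_int that \<l>(4) \<l>_int1 z_in
      by (intro integral_mono integrable_norm Bochner_Integration.integrable_diff integrable_mult_left)
        (auto simp: dist_norm)
    finally show ?thesis by (simp add: E\<l>_def)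
  qed
  \<comment> \<open>The exceptional set comes from finitely many overlap conditions and is the same
    for all parameters; hence the bound may be used at the random estimate.\<close>
  have S_lip: "AE \<omega> in M. \<forall>\<theta>\<in>\<Theta>. \<forall>\<theta>'\<in>\<Theta>. norm (S t \<theta> \<omega> - S t \<theta>' \<omega>) \<le> Z t \<omega> * dist \<theta> \<theta>'" for t
  proof -
    have "AE \<omega> in M. \<forall>\<tau>\<in>{1..t}. P \<tau> \<omega> $ a \<ge> \<pi>min"
      using overlap by (intro AE_finite_allI) auto
    with AE_space show ?thesis
    proof eventually_elim
      case (elim \<omega>)
      show ?case
      proof (intro ballI)
        fix \<theta> \<theta>' assume \<theta>: "\<theta> \<in> \<Theta>" "\<theta>' \<in> \<Theta>"
        have "norm (S t \<theta> \<omega> - S t \<theta>' \<omega>) =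
            (1 / real t) * norm (\<Sum>\<tau>=1..t. ipw a (\<lambda>z. g z \<theta>) \<tau> \<omega> - ipw a (\<lambda>z. g z \<theta>') \<tau> \<omega>)"
          unfolding S_def scaleR_diff_right[symmetric] sum_subtractf[symmetric] by simp
        also have "\<dots> \<le> (1 / real t) * (\<Sum>\<tau>=1..t. \<l> (X \<tau> \<omega>, Y \<tau> \<omega> $ a) / \<pi>min * dist \<theta> \<theta>')"
        proof (intro mult_left_mono sum_norm_le)
          fix \<tau> assume \<tau>: "\<tau> \<in> {1..t}"
          then have P: "\<pi>min \<le> P \<tau> \<omega> $ a" using elim by auto
          have z: "(X \<tau> \<omega>, Y \<tau> \<omega> $ a) \<in> \<X> \<times> UNIV" using z_in elim \<tau> by auto
          have "norm (ipw a (\<lambda>z. g z \<theta>) \<tau> \<omega> - ipw a (\<lambda>z. g z \<theta>') \<tau> \<omega>)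
              \<le> 1 / P \<tau> \<omega> $ a * dist (g (X \<tau> \<omega>, Y \<tau> \<omega> $ a) \<theta>) (g (X \<tau> \<omega>, Y \<tau> \<omega> $ a) \<theta>')"
            unfolding ipw_eq scaleR_diff_right[symmetric] using P \<pi>min by (auto simp: indicator_def dist_norm)
          also have "\<dots> \<le> 1 / \<pi>min * (\<l> (X \<tau> \<omega>, Y \<tau> \<omega> $ a) * dist \<theta> \<theta>')"
            using P \<pi>min \<l>(4)[OF z \<theta>] by (intro mult_mono divide_left_mono) auto
          finally show "norm (ipw a (\<lambda>z. g z \<theta>) \<tau> \<omega> - ipw a (\<lambda>z. g z \<theta>') \<tau> \<omega>) \<le> \<l> (X \<tau> \<omega>, Y \<tau> \<omega> $ a) / \<pi>min * dist \<theta> \<theta>'"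
            by simp
        qed simp
        also have "\<dots> = Z t \<omega> * dist \<theta> \<theta>'"
          by (simp only: Z_def sum_distrib_right mult.assoc)
        finally show "norm (S t \<theta> \<omega> - S t \<theta>' \<omega>) \<le> Z t \<omega> * dist \<theta> \<theta>'" .
      qed
    qed
  qed
  have ST_measurable: "(\<lambda>\<omega>. S t (T t \<omega>) \<omega>) \<in> borel_measurable M" for t
    unfolding S_def by (rule ipw_average_measurable[OF gm cont T(1)])
  show ?thesis
  proof (rule LIMSEQ_I)
    fix r :: real assume r: "r > 0"
    \<comment> \<open>\<open>K\<close> dominates the Lipschitz constant \<open>E\<l>\<close> of
      \<open>G\<close> and the mean of \<open>Z\<close>; the summand 1 keeps it positive. The first
      bound on \<open>\<rho>\<close> lets \<open>G\<close> move by at most \<open>\<eta> / 4\<close>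
      to a net point, the second limits the share of \<open>Z\<close> in the final probability to
      \<open>r / 4\<close>.\<close>
    define K where "K = E\<l> + E\<l> / \<pi>min + 1"
    have K: "K > 0" "E\<l> \<le> K" "E\<l> / \<pi>min \<le> K" using E\<l> \<pi>min by (auto simp: K_def add_nonneg_pos)
    define \<rho> where "\<rho> = min (\<eta> / 4 / K) (r * \<eta> / 8 / K)"
    have "\<rho> > 0" using K(1) r \<eta>(1) by (simp add: \<rho>_def)
    moreover have "\<rho> \<le> \<eta> / 4 / K" "\<rho> \<le> r * \<eta> / 8 / K" by (auto simp: \<rho>_def)
    ultimately have \<rho>: "\<rho> > 0" "\<rho> * K \<le> \<eta> / 4" "\<rho> * K \<le> r * \<eta> / 8"
      unfolding pos_le_divide_eq[OF K(1)] .
    have "\<Theta> \<subseteq> (\<Union>\<theta>\<in>\<Theta>. ball \<theta> \<rho>)" using \<rho>(1) by auto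
    then obtain F where F: "F \<subseteq> \<Theta>" "finite F" "\<Theta> \<subseteq> (\<Union>\<theta>\<in>F. ball \<theta> \<rho>)"
      by (rule compactE_image[OF \<Theta>, rotated]) auto
    \<comment> \<open>\<open>W\<close> gathers the errors that do not involve the estimate, so its
      expectation is computable and Markov's inequality applies.\<close>
    define W where "W t \<omega> = (\<Sum>\<theta>\<in>F. norm (S t \<theta> \<omega> - G \<theta>)) + \<rho> * Z t \<omega>" for t \<omega>
    have W_int: "integrable M (W t)" for t
      unfolding W_def using S_int F(1) Z_int
      by (intro Bochner_Integration.integrable_add Bochner_Integration.integrable_sum integrable_norm
          Bochner_Integration.integrable_diff integrable_mult_right) auto
    have W_nonneg: "0 \<le> W t \<omega>" if "\<omega> \<in> space M" for t \<omega>
      unfolding W_def using Z_nonneg that \<rho>(1) by (intro add_nonneg_nonneg sum_nonneg mult_nonneg_nonneg) auto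
    have EW: "(\<integral>\<omega>. W t \<omega> \<partial>M) = (\<Sum>\<theta>\<in>F. \<integral>\<omega>. norm (S t \<theta> \<omega> - G \<theta>) \<partial>M) + \<rho> * (E\<l> / \<pi>min)" if "t \<ge> 1" for t
    proof -
      have "integrable M (\<lambda>\<omega>. norm (S t \<theta> \<omega> - G \<theta>))" if "\<theta> \<in> F" for \<theta>
        using S_int F(1) that by (intro integrable_norm Bochner_Integration.integrable_diff) auto
      then show ?thesis
        unfolding W_def using Z_int EZ[OF that]
        by (subst Bochner_Integration.integral_add) (auto simp: Bochner_Integration.integral_sum)
    qed
    \<comment> \<open>Far from \<open>\<theta>\<^sub>0\<close>, the score at the estimate and
      \<open>W\<close> together reach \<open>3 * \<eta> / 4\<close>; if the former is at most
      \<open>\<eta> / 8\<close>, then \<open>W\<close> exceeds \<open>\<eta> / 2\<close>.\<close>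
    have bad: "prob {\<omega> \<in> space M. dist (T t \<omega>) \<theta>\<^sub>0 > \<epsilon>} \<le>
        prob {\<omega> \<in> space M. norm (S t (T t \<omega>) \<omega> - 0) > \<eta> / 8} + 2 / \<eta> * (\<integral>\<omega>. W t \<omega> \<partial>M)" for t
    proof -
      note T(1)[of t, measurable] ST_measurable[of t, measurable]
      have [measurable]: "W t \<in> borel_measurable M" using W_int by auto
      have "prob {\<omega> \<in> space M. dist (T t \<omega>) \<theta>\<^sub>0 > \<epsilon>} \<le>
          prob ({\<omega> \<in> space M. norm (S t (T t \<omega>) \<omega> - 0) > \<eta> / 8} \<union> {\<omega> \<in> space M. W t \<omega> \<ge> \<eta> / 2})"
      proof (rule finite_measure_mono_AE)
        show "AE \<omega> in M. \<omega> \<in> {\<omega> \<in> space M. dist (T t \<omega>) \<theta>\<^sub>0 > \<epsilon>} \<longrightarrow>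
            \<omega> \<in> {\<omega> \<in> space M. norm (S t (T t \<omega>) \<omega> - 0) > \<eta> / 8} \<union> {\<omega> \<in> space M. W t \<omega> \<ge> \<eta> / 2}"
          using S_lip[of t] AE_space
        proof (eventually_elim, intro impI)
          fix \<omega> assume lipS: "\<forall>\<theta>\<in>\<Theta>. \<forall>\<theta>'\<in>\<Theta>. norm (S t \<theta> \<omega> - S t \<theta>' \<omega>) \<le> Z t \<omega> * dist \<theta> \<theta>'"
            and \<omega>: "\<omega> \<in> space M" and "\<omega> \<in> {\<omega> \<in> space M. dist (T t \<omega>) \<theta>\<^sub>0 > \<epsilon>}"
          then have far: "dist (T t \<omega>) \<theta>\<^sub>0 > \<epsilon>" by auto
          let ?\<theta> = "T t \<omega>"
          have \<theta>: "?\<theta> \<in> \<Theta>" by (rule T(2)[OF \<omega>])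
          then obtain \<theta>' where \<theta>': "\<theta>' \<in> F" "dist ?\<theta> \<theta>' < \<rho>"
            using F(3) by (auto simp: dist_commute)
          then have \<theta>'\<Theta>: "\<theta>' \<in> \<Theta>" using F(1) by auto
          have "\<eta> \<le> norm (G ?\<theta>)"
            unfolding G_def by (rule \<eta>(2)[OF \<theta> far])
          also have "\<dots> \<le> norm (S t ?\<theta> \<omega>) + norm (S t ?\<theta> \<omega> - S t \<theta>' \<omega>) + norm (S t \<theta>' \<omega> - G \<theta>') + norm (G ?\<theta> - G \<theta>')"
            by norm
          also have "norm (S t ?\<theta> \<omega> - S t \<theta>' \<omega>) \<le> \<rho> * Z t \<omega>"
          proof -
            have "norm (S t ?\<theta> \<omega> - S t \<theta>' \<omega>) \<le> Z t \<omega> * dist ?\<theta> \<theta>'"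
              using lipS \<theta> \<theta>'\<Theta> by auto
            also have "\<dots> \<le> Z t \<omega> * \<rho>" using \<theta>' Z_nonneg[OF \<omega>] by (intro mult_left_mono) auto
            finally show ?thesis by (simp add: mult.commute)
          qed
          also have "norm (S t \<theta>' \<omega> - G \<theta>') \<le> (\<Sum>\<theta>\<in>F. norm (S t \<theta> \<omega> - G \<theta>))"
            using \<theta>'(1) F(2) by (intro member_le_sum) auto
          also have "norm (G ?\<theta> - G \<theta>') \<le> \<eta> / 4"
          proof -
            have "norm (G ?\<theta> - G \<theta>') \<le> E\<l> * dist ?\<theta> \<theta>'" by (rule G_lip[OF \<theta> \<theta>'\<Theta>])
            also have "\<dots> \<le> K * \<rho>" using K \<theta>' E\<l> by (intro mult_mono) auto
            finally show ?thesis using \<rho>(2) by (simp add: mult.commute)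
          qed
          finally have "\<eta> \<le> norm (S t ?\<theta> \<omega>) + W t \<omega> + \<eta> / 4" by (simp add: W_def)
          then show "\<omega> \<in> {\<omega> \<in> space M. norm (S t (T t \<omega>) \<omega> - 0) > \<eta> / 8} \<union> {\<omega> \<in> space M. W t \<omega> \<ge> \<eta> / 2}"
            using \<omega> \<eta>(1) by auto
        qed
      qed measurable
      also have "\<dots> \<le> prob {\<omega> \<in> space M. norm (S t (T t \<omega>) \<omega> - 0) > \<eta> / 8} + prob {\<omega> \<in> space M. W t \<omega> \<ge> \<eta> / 2}"
        by (rule measure_Un_le) measurable
      also have "prob {\<omega> \<in> space M. W t \<omega> \<ge> \<eta> / 2} \<le> (\<integral>\<omega>. W t \<omega> \<partial>M) / (\<eta> / 2)"
        using W_int W_nonneg \<eta>(1) by (intro integral_Markov_inequality_measure[where A="{}"]) auto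
      finally show ?thesis by (simp add: mult.commute)
    qed
    have "(\<lambda>t. prob {\<omega> \<in> space M. norm (S t (T t \<omega>) \<omega> - 0) > \<eta> / 8} +
        2 / \<eta> * (\<Sum>\<theta>\<in>F. \<integral>\<omega>. norm (S t \<theta> \<omega> - G \<theta>) \<partial>M)) \<longlonglongrightarrow> 0 + 2 / \<eta> * (\<Sum>\<theta>\<in>F. 0)"
    proof (intro tendsto_add tendsto_mult tendsto_const tendsto_sum)
      show "(\<lambda>t. prob {\<omega> \<in> space M. norm (S t (T t \<omega>) \<omega> - 0) > \<eta> / 8}) \<longlonglongrightarrow> 0"
        unfolding S_def
        by (rule root[unfolded converges_in_prob_def, rule_format]) (use \<eta>(1) in simp)
    qed (use S_lim F(1) in auto)
    then have "(\<lambda>t. prob {\<omega> \<in> space M. norm (S t (T t \<omega>) \<omega> - 0) > \<eta> / 8} +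
        2 / \<eta> * (\<Sum>\<theta>\<in>F. \<integral>\<omega>. norm (S t \<theta> \<omega> - G \<theta>) \<partial>M)) \<longlonglongrightarrow> 0" by simp
    from LIMSEQ_D[OF this, of "r/2"] r obtain n where n: "\<forall>t\<ge>n. norm (prob {\<omega> \<in> space M. norm (S t (T t \<omega>) \<omega> - 0) > \<eta> / 8} +
        2 / \<eta> * (\<Sum>\<theta>\<in>F. \<integral>\<omega>. norm (S t \<theta> \<omega> - G \<theta>) \<partial>M) - 0) < r / 2" by auto
    show "\<exists>no. \<forall>t\<ge>no. norm (prob {\<omega> \<in> space M. dist (T t \<omega>) \<theta>\<^sub>0 > \<epsilon>} - 0) < r"
    proof (intro exI[of _ "max n 1"] allI impI)
      fix t assume t: "max n 1 \<le> t"
      let ?a = "prob {\<omega> \<in> space M. norm (S t (T t \<omega>) \<omega> - 0) > \<eta> / 8}"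
      let ?b = "\<Sum>\<theta>\<in>F. \<integral>\<omega>. norm (S t \<theta> \<omega> - G \<theta>) \<partial>M"
      have "prob {\<omega> \<in> space M. dist (T t \<omega>) \<theta>\<^sub>0 > \<epsilon>} \<le> ?a + 2 / \<eta> * (?b + \<rho> * (E\<l> / \<pi>min))"
        using bad[of t] EW[of t] t by simp
      also have "\<dots> = (?a + 2 / \<eta> * ?b) + 2 / \<eta> * (\<rho> * (E\<l> / \<pi>min))"
        by (simp only: distrib_left add.assoc)
      also have "?a + 2 / \<eta> * ?b < r / 2"
        using n[rule_format, of t] t unfolding real_norm_def by linarith
      also have "2 / \<eta> * (\<rho> * (E\<l> / \<pi>min)) \<le> 2 / \<eta> * (r * \<eta> / 8)"
      proof (intro mult_left_mono)
        have "\<rho> * (E\<l> / \<pi>min) \<le> \<rho> * K" using K(3) \<rho>(1) by (intro mult_left_mono) auto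
        then show "\<rho> * (E\<l> / \<pi>min) \<le> r * \<eta> / 8" using \<rho>(3) by linarith
      qed (use \<eta>(1) in simp)
      also have "r / 2 + 2 / \<eta> * (r * \<eta> / 8) \<le> r"
        using \<eta>(1) r by simp
      finally show "norm (prob {\<omega> \<in> space M. dist (T t \<omega>) \<theta>\<^sub>0 > \<epsilon>} - 0) < r" by simp
    qed
  qed
qed

end

section \<open>Convergence of the behavior policy\<close>

text \<open>Dividing by a rate of at most 1 can only enlarge the norm. The condition on
  \<open>r\<close> is eventual since the root rate is 0 at time 0.\<close>

lemma little_o_p_imp_converges_in_prob:
  fixes Z :: "nat \<Rightarrow> 'w \<Rightarrow> 'b::{real_normed_vector, second_countable_topology}"
  assumes "prob_space M" and Z: "\<And>t. Z t \<in> borel_measurable M"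
    and r: "\<forall>\<^sub>F t in sequentially. 0 < r t \<and> r t \<le> 1"
    and o: "little_o_p M Z r"
  shows "converges_in_prob M Z (\<lambda>_. 0)"
  unfolding converges_in_prob_def
proof (intro allI impI)
  interpret prob_space M by fact
  fix \<epsilon> :: real assume \<epsilon>: "\<epsilon> > 0"
  have lim: "(\<lambda>t. prob {\<omega> \<in> space M. norm (Z t \<omega> /\<^sub>R r t - 0) > \<epsilon>}) \<longlonglongrightarrow> 0"
    using o \<epsilon> by (simp add: little_o_p_def converges_in_prob_def)
  show "(\<lambda>t. prob {\<omega> \<in> space M. norm (Z t \<omega> - 0) > \<epsilon>}) \<longlonglongrightarrow> 0"
  proof (rule Lim_null_comparison[OF _ lim])
    show "\<forall>\<^sub>F t in sequentially. norm (prob {\<omega> \<in> space M. norm (Z t \<omega> - 0) > \<epsilon>})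
        \<le> prob {\<omega> \<in> space M. norm (Z t \<omega> /\<^sub>R r t - 0) > \<epsilon>}"
      using r
    proof eventually_elim
      case (elim t)
      note Z[of t, measurable]
      have "norm (Z t \<omega>) \<le> norm (Z t \<omega> /\<^sub>R r t)" for \<omega>
        using elim mult_right_mono[of 1 "inverse (r t)" "norm (Z t \<omega>)"]
        by (simp add: one_le_inverse)
      then have "prob {\<omega> \<in> space M. norm (Z t \<omega> - 0) > \<epsilon>} \<le> prob {\<omega> \<in> space M. norm (Z t \<omega> /\<^sub>R r t - 0) > \<epsilon>}"
        by (intro finite_measure_mono) (auto intro: less_le_trans)
      then show ?case by simp
    qed
  qed
qed

lemma norm_vec_le_sum: "norm (v :: 'a::real_normed_vector^'n) \<le> (\<Sum>i\<in>UNIV. norm (v $ i))"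
  unfolding norm_vec_def by (rule L2_set_le_sum) simp

theorem proposition4p3:
  fixes M :: "'w measure"
    and \<X> :: "(real^'x) set"
    and X :: "nat \<Rightarrow> 'w \<Rightarrow> real^'x"
    and Y P :: "nat \<Rightarrow> 'w \<Rightarrow> real^'k"
    and A :: "nat \<Rightarrow> 'w \<Rightarrow> 'k"
    and g :: "real^'x \<Rightarrow> real \<Rightarrow> real^'d \<Rightarrow> real^'d"
    and \<theta>s :: "real^'d^'k"
    and est :: "nat \<Rightarrow> (nat \<Rightarrow> ('x, 'k) record_t) \<Rightarrow> real^'d^'k"
    and \<theta>hat :: "nat \<Rightarrow> 'w \<Rightarrow> real^'d^'k"
    and \<gamma> :: "nat \<Rightarrow> real^'c" and \<gamma>s :: "real^'c"
    and pol :: "real^'x \<Rightarrow> real^'d^'k \<Rightarrow> real^'c \<Rightarrow> real^'k"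
    and R\<theta> M\<^sub>2 \<pi>min :: real
  assumes bandit: "contextual_bandit M \<X> X Y P A"
    and g_measurable: "\<And>\<theta>. (\<lambda>(x, y). g x y \<theta>) \<in>
          borel_measurable (restrict_space borel \<X> \<Otimes>\<^sub>M (borel :: real measure))"
    and root: "\<And>a t. t \<ge> 1 \<Longrightarrow> (\<integral>\<omega>. g (X t \<omega>) (Y t \<omega> $ a) (\<theta>s $ a) \<partial>M) = 0"
    and unconfounded: "\<And>t. t \<ge> 1 \<Longrightarrow>
          cond_indep_var M (decision_sigma M X Y P A t) (count_space UNIV) (A t) borel (Y t)"
    and identification: "\<And>a t \<epsilon>. t \<ge> 1 \<Longrightarrow> \<epsilon> > 0 \<Longrightarrow>
          (INF \<theta>\<in>{\<theta>. norm (\<theta> - \<theta>s $ a) > \<epsilon>}. norm (\<integral>\<omega>. g (X t \<omega>) (Y t \<omega> $ a) \<theta> \<partial>M)) > 0"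
    and cond_second_moment: "\<And>a t. t \<ge> 1 \<Longrightarrow> AE \<omega> in M.
          spectral_norm (matrix_cond_exp M (vimage_algebra (space M) (X t) borel)
            (\<lambda>\<omega>. outer (g (X t \<omega>) (Y t \<omega> $ a) (\<theta>s $ a)) (g (X t \<omega>) (Y t \<omega> $ a) (\<theta>s $ a))) \<omega>) \<le> M\<^sub>2"
    and root_bound: "\<And>a. norm (\<theta>s $ a) < R\<theta>"
    and second_moment: "\<And>a t. t \<ge> 1 \<Longrightarrow>
          (SUP \<theta>\<in>cball 0 R\<theta>. \<integral>\<^sup>+\<omega>. ennreal ((norm (g (X t \<omega>) (Y t \<omega> $ a) \<theta>))^2) \<partial>M) < \<infinity>"
    and fourth_moment: "\<And>a t. t \<ge> 1 \<Longrightarrow>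
          (\<integral>\<^sup>+\<omega>. ennreal ((norm (g (X t \<omega>) (Y t \<omega> $ a) (\<theta>s $ a)))^4) \<partial>M) < \<infinity>"
    and g_smooth: "\<And>x y. x \<in> \<X> \<Longrightarrow> twice_differentiable (g x y)"
    and nonsingular: "\<And>a t. t \<ge> 1 \<Longrightarrow>
          invertible (\<integral>\<omega>. jacobian (g (X t \<omega>) (Y t \<omega> $ a)) (at (\<theta>s $ a)) \<partial>M)"
    and jacobian_bound: "\<And>a. \<exists>\<phi> :: real^'x \<Rightarrow> real \<Rightarrow> real.
          (\<forall>x\<in>\<X>. \<forall>y. \<forall>\<theta>. norm \<theta> \<le> R\<theta> \<longrightarrow> spectral_norm (jacobian (g x y) (at \<theta>)) \<le> \<phi> x y) \<and>
          (\<forall>t\<ge>1. integrable M (\<lambda>\<omega>. (\<phi> (X t \<omega>) (Y t \<omega> $ a))^2))"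
    and hessian_bound: "\<And>a. \<exists>\<epsilon>\<^sub>0>0. \<exists>\<Phi> :: real^'x \<Rightarrow> real \<Rightarrow> real.
          (\<forall>x\<in>\<X>. \<forall>y. \<forall>\<theta> i. norm (\<theta> - \<theta>s $ a) \<le> \<epsilon>\<^sub>0 \<longrightarrow>
             spectral_norm (hessian (\<lambda>\<theta>'. g x y \<theta>' $ i) \<theta>) \<le> \<Phi> x y) \<and>
          (\<forall>t\<ge>1. integrable M (\<lambda>\<omega>. \<Phi> (X t \<omega>) (Y t \<omega> $ a)))"
    and \<pi>min: "0 < \<pi>min" "\<pi>min < 1"
    and overlap: "\<And>a t. t \<ge> 1 \<Longrightarrow> AE \<omega> in M. P t \<omega> $ a \<ge> \<pi>min"
    and est_measurable: "\<And>t. est t \<in> borel_measurable (history_space t)"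
    and \<theta>hat: "\<And>t \<omega>. \<omega> \<in> space M \<Longrightarrow> \<theta>hat t \<omega> = est t (history X Y P A t \<omega>)"
    and \<theta>hat_bound: "\<And>a t \<omega>. \<omega> \<in> space M \<Longrightarrow> norm (\<theta>hat t \<omega> $ a) \<le> R\<theta>"
    and \<theta>hat_root: "\<And>a. little_o_p M
          (\<lambda>t \<omega>. (1 / real t) *\<^sub>R (\<Sum>\<tau>=1..t.
             (indicator {a} (A \<tau> \<omega>) / P \<tau> \<omega> $ A \<tau> \<omega>) *\<^sub>R
               g (X \<tau> \<omega>) (Y \<tau> \<omega> $ A \<tau> \<omega>) (\<theta>hat t \<omega> $ a)))
          (\<lambda>t. 1 / sqrt (real t))"
    and \<gamma>: "\<gamma> \<longlonglongrightarrow> \<gamma>s"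
    and pol_measurable: "(\<lambda>(x, \<theta>, c). pol x \<theta> c) \<in>
          borel_measurable (restrict_space borel \<X> \<Otimes>\<^sub>M
            (borel :: (real^'d^'k) measure) \<Otimes>\<^sub>M (borel :: (real^'c) measure))"
    and pol_simplex: "\<And>x \<theta> c. x \<in> \<X> \<Longrightarrow> pol x \<theta> c \<in> prob_simplex"
    and pol_cont: "\<And>t. t \<ge> 1 \<Longrightarrow> AE x in distr M (restrict_space borel \<X>) (X t).
          isCont (\<lambda>(\<theta>, c). pol x \<theta> c) (\<theta>s, \<gamma>s)"
    and behavior: "\<And>t \<omega>. t \<ge> 1 \<Longrightarrow> \<omega> \<in> space M \<Longrightarrow>
          P t \<omega> = pol (X t \<omega>) (\<theta>hat (t - 1) \<omega>) (\<gamma> (t - 1))"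
  shows "\<forall>a. converges_in_prob M
           (\<lambda>t \<omega>. P t \<omega> $ a - pol (X t \<omega>) \<theta>s \<gamma>s $ a) (\<lambda>_. 0)"
proof -
  interpret ipw_bandit M \<X> X Y P A \<pi>min
    using bandit unconfounded \<pi>min(1) overlap by unfold_locales auto
  \<comment> \<open>Pairing context and outcome into one argument gives the score the form that
    \<open>ipw\<close> expects.\<close>
  define G where "G z \<theta> = g (fst z) (snd z) \<theta>" for z \<theta>
  have gm: "(\<lambda>z. G z \<theta>) \<in> borel_measurable (ctx_space \<Otimes>\<^sub>M borel)" for \<theta>
    using g_measurable[of \<theta>] by (simp add: G_def split_beta')
  have diff: "(G z has_derivative (\<lambda>v. jacobian (G z) (at \<theta>) *v v)) (at \<theta>)" if "z \<in> \<X> \<times> UNIV" for z \<theta>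
    using g_smooth[of "fst z" "snd z"] that jacobian_works[of "G z" "at \<theta>"]
    by (auto simp: twice_differentiable_def G_def[abs_def])
  have cont: "continuous_on UNIV (G z)" if "z \<in> \<X> \<times> UNIV" for z
    using has_derivative_continuous[OF diff[OF that]] by (simp add: continuous_on_eq_continuous_at)
  have \<theta>hat_hist: "\<theta>hat t \<in> borel_measurable (hist_sigma t)" for t
    using measurable_compose[OF history_hist est_measurable] \<theta>hat
    by (subst measurable_cong[where g = "\<lambda>\<omega>. est t (history X Y P A t \<omega>)"]) auto
  have \<theta>hat_meas: "\<theta>hat t \<in> borel_measurable M" for t
    using measurable_from_subalg[OF subalgebra_hist \<theta>hat_hist] .
  have \<theta>hat_a_meas: "(\<lambda>\<omega>. \<theta>hat t \<omega> $ a) \<in> borel_measurable M" for t a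
    by (rule measurable_compose[OF \<theta>hat_meas])
      (intro borel_measurable_continuous_onI continuous_intros)
  have consistent: "(\<lambda>t. prob {\<omega> \<in> space M. dist (\<theta>hat t \<omega> $ a) (\<theta>s $ a) > \<epsilon>}) \<longlonglongrightarrow> 0" if \<epsilon>: "\<epsilon> > 0" for a \<epsilon>
  proof -
    obtain \<phi> where \<phi>: "\<And>x y \<theta>. x \<in> \<X> \<Longrightarrow> norm \<theta> \<le> R\<theta> \<Longrightarrow> spectral_norm (jacobian (g x y) (at \<theta>)) \<le> \<phi> x y"
        "\<And>t. t \<ge> 1 \<Longrightarrow> integrable M (\<lambda>\<omega>. (\<phi> (X t \<omega>) (Y t \<omega> $ a))\<^sup>2)"
      using jacobian_bound[of a] by blast
    \<comment> \<open>The sign follows from an operator norm at \<open>\<theta>s $ a\<close>, which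
      lies inside the ball.\<close>
    have \<phi>0: "0 \<le> \<phi> x y" if "x \<in> \<X>" for x y
    proof -
      have "0 \<le> spectral_norm (jacobian (g x y) (at (\<theta>s $ a)))"
        unfolding spectral_norm_def by (intro onorm_pos_le matrix_vector_mul_bounded_linear)
      also have "\<dots> \<le> \<phi> x y" using \<phi>(1)[OF that] root_bound[of a] by simp
      finally show ?thesis .
    qed
    define \<eta> where "\<eta> = (INF \<theta>\<in>{\<theta>. norm (\<theta> - \<theta>s $ a) > \<epsilon>}. norm (\<integral>\<omega>. G (X 1 \<omega>, Y 1 \<omega> $ a) \<theta> \<partial>M))"
    show ?thesis
    \<comment> \<open>The closed ball contains the estimates; it is convex, for the mean value
      inequality, and compact, for the finite net.\<close>
    proof (rule z_estimator_consistent[where g = G and \<Theta> = "cball 0 R\<theta>" and \<phi> = "case_prod \<phi>" and \<eta> = \<eta> and a = a])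
      fix z and \<theta> \<theta>' :: "real^'d"
      assume z: "z \<in> \<X> \<times> (UNIV :: real set)" and \<theta>: "\<theta> \<in> cball 0 R\<theta>" "\<theta>' \<in> cball 0 R\<theta>"
      show "dist (G z \<theta>) (G z \<theta>') \<le> case_prod \<phi> z * dist \<theta> \<theta>'"
        unfolding dist_norm
      proof (rule differentiable_bound[OF convex_cball _ _ \<theta>])
        show "(G z has_derivative (\<lambda>v. jacobian (G z) (at \<theta>) *v v)) (at \<theta> within cball 0 R\<theta>)" for \<theta>
          by (rule has_derivative_at_withinI[OF diff[OF z]])
        show "onorm (\<lambda>v. jacobian (G z) (at \<theta>) *v v) \<le> case_prod \<phi> z" if "\<theta> \<in> cball 0 R\<theta>" for \<theta>
          using \<phi>(1)[of "fst z" \<theta> "snd z"] z that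
          by (auto simp: spectral_norm_def G_def[abs_def])
      qed
    next
      fix \<theta> :: "real^'d" assume \<theta>: "\<theta> \<in> cball 0 R\<theta>"
      have "(\<lambda>\<omega>. G (X 1 \<omega>, Y 1 \<omega> $ a) \<theta>) \<in> borel_measurable M"
        by (rule measurable_compose[OF outcome_ctx gm]) simp
      moreover have "(\<integral>\<^sup>+\<omega>. ennreal ((norm (G (X 1 \<omega>, Y 1 \<omega> $ a) \<theta>))\<^sup>2) \<partial>M) < \<infinity>"
        using le_less_trans[OF SUP_upper[OF \<theta>] second_moment[of 1 a]] by (simp add: G_def)
      ultimately show "integrable M (\<lambda>\<omega>. (norm (G (X 1 \<omega>, Y 1 \<omega> $ a) \<theta>))\<^sup>2)"
        by (intro integrableI_bounded) auto
    next
      show "\<eta> > 0"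
        using identification[of 1 \<epsilon> a] \<epsilon> by (simp add: \<eta>_def G_def)
    next
      fix \<theta> :: "real^'d" assume "dist \<theta> (\<theta>s $ a) > \<epsilon>"
      then show "\<eta> \<le> norm (\<integral>\<omega>. G (X 1 \<omega>, Y 1 \<omega> $ a) \<theta> \<partial>M)"
        unfolding \<eta>_def by (intro cINF_lower bdd_belowI2[where m = 0]) (auto simp: dist_norm)
    next
      show "converges_in_prob M (\<lambda>t \<omega>. (1 / real t) *\<^sub>R (\<Sum>\<tau>=1..t. ipw a (\<lambda>z. G z (\<theta>hat t \<omega> $ a)) \<tau> \<omega>)) (\<lambda>_. 0)"
      proof (rule little_o_p_imp_converges_in_prob)
        show "\<forall>\<^sub>F t in sequentially. 0 < 1 / sqrt (real t) \<and> 1 / sqrt (real t) \<le> 1"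
          using eventually_ge_at_top[of "1::nat"] by eventually_elim auto
        show "little_o_p M (\<lambda>t \<omega>. (1 / real t) *\<^sub>R (\<Sum>\<tau>=1..t. ipw a (\<lambda>z. G z (\<theta>hat t \<omega> $ a)) \<tau> \<omega>)) (\<lambda>t. 1 / sqrt (real t))"
          using \<theta>hat_root[of a] by (simp add: ipw_def G_def)
        show "(\<lambda>\<omega>. (1 / real t) *\<^sub>R (\<Sum>\<tau>=1..t. ipw a (\<lambda>z. G z (\<theta>hat t \<omega> $ a)) \<tau> \<omega>)) \<in> borel_measurable M" for t
          by (rule ipw_average_measurable[OF gm cont \<theta>hat_a_meas])
      qed unfold_locales
    qed (use gm cont \<phi>(2)[of 1] \<phi>0 \<theta>hat_a_meas \<theta>hat_bound in auto)
  qed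
  \<comment> \<open>The policy at time \<open>t\<close> uses the estimate from time
    \<open>t - 1\<close>. This shift makes \<open>V t\<close> measurable for the past, hence
    independent of \<open>X t\<close>.\<close>
  define V where "V t \<omega> = (\<theta>hat (t - 1) \<omega>, \<gamma> (t - 1))" for t \<omega>
  have V_lim: "(\<lambda>t. prob {\<omega> \<in> space M. dist (V t \<omega>) (\<theta>s, \<gamma>s) > \<epsilon>}) \<longlonglongrightarrow> 0" if \<epsilon>: "\<epsilon> > 0" for \<epsilon>
  proof -
    \<comment> \<open>Half of \<open>\<epsilon>\<close> is shared among the actions and the other
      half is left for \<open>\<gamma>\<close>.\<close>
    define \<delta> where "\<delta> = \<epsilon> / (2 * real CARD('k))"
    have \<delta>: "\<delta> > 0" using \<epsilon> by (simp add: \<delta>_def)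
    have "(\<lambda>t. \<Sum>a\<in>UNIV. prob {\<omega> \<in> space M. dist (\<theta>hat (t - 1) \<omega> $ a) (\<theta>s $ a) > \<delta>}) \<longlonglongrightarrow> (\<Sum>a\<in>(UNIV :: 'k set). 0)"
      by (intro tendsto_sum filterlim_compose[OF consistent[OF \<delta>] filterlim_minus_const_nat_at_top])
    then have lim: "(\<lambda>t. \<Sum>a\<in>UNIV. prob {\<omega> \<in> space M. dist (\<theta>hat (t - 1) \<omega> $ a) (\<theta>s $ a) > \<delta>}) \<longlonglongrightarrow> 0"
      unfolding sum.neutral_const .
    have \<gamma>': "(\<lambda>t. \<gamma> (t - 1)) \<longlonglongrightarrow> \<gamma>s"
      by (rule filterlim_compose[OF \<gamma> filterlim_minus_const_nat_at_top])
    show ?thesis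
    proof (rule Lim_null_comparison[OF _ lim])
      have "\<forall>\<^sub>F t in sequentially. dist (\<gamma> (t - 1)) \<gamma>s < \<epsilon> / 2"
        using tendstoD[OF \<gamma>', of "\<epsilon> / 2"] \<epsilon> by simp
      then show "\<forall>\<^sub>F t in sequentially. norm (prob {\<omega> \<in> space M. dist (V t \<omega>) (\<theta>s, \<gamma>s) > \<epsilon>})
          \<le> (\<Sum>a\<in>UNIV. prob {\<omega> \<in> space M. dist (\<theta>hat (t - 1) \<omega> $ a) (\<theta>s $ a) > \<delta>})"
      proof eventually_elim
        case (elim t)
        note \<theta>hat_a_meas[of "t - 1", measurable]
        have meas: "{\<omega> \<in> space M. dist (\<theta>hat (t - 1) \<omega> $ a) (\<theta>s $ a) > \<delta>} \<in> events" for a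
          by measurable
        have "{\<omega> \<in> space M. dist (V t \<omega>) (\<theta>s, \<gamma>s) > \<epsilon>}
            \<subseteq> (\<Union>a. {\<omega> \<in> space M. dist (\<theta>hat (t - 1) \<omega> $ a) (\<theta>s $ a) > \<delta>})"
        proof (rule subsetI, rule ccontr)
          fix \<omega> assume "\<omega> \<in> {\<omega> \<in> space M. dist (V t \<omega>) (\<theta>s, \<gamma>s) > \<epsilon>}"
            and "\<omega> \<notin> (\<Union>a. {\<omega> \<in> space M. dist (\<theta>hat (t - 1) \<omega> $ a) (\<theta>s $ a) > \<delta>})"
          then have \<omega>: "\<omega> \<in> space M" "dist (V t \<omega>) (\<theta>s, \<gamma>s) > \<epsilon>"
              "\<And>a. dist (\<theta>hat (t - 1) \<omega> $ a) (\<theta>s $ a) \<le> \<delta>"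
            by (auto simp: not_less)
          have "norm (\<theta>hat (t - 1) \<omega> - \<theta>s) \<le> (\<Sum>a\<in>UNIV. norm ((\<theta>hat (t - 1) \<omega> - \<theta>s) $ a))"
            by (rule norm_vec_le_sum)
          also have "\<dots> \<le> real CARD('k) * \<delta>"
            using \<omega>(3) by (intro sum_bounded_above) (simp add: dist_norm)
          also have "\<dots> = \<epsilon> / 2" by (simp add: \<delta>_def)
          finally have "norm (\<theta>hat (t - 1) \<omega> - \<theta>s) + norm (\<gamma> (t - 1) - \<gamma>s) < \<epsilon>"
            using elim by (simp add: dist_norm)
          moreover have "dist (V t \<omega>) (\<theta>s, \<gamma>s) \<le> norm (\<theta>hat (t - 1) \<omega> - \<theta>s) + norm (\<gamma> (t - 1) - \<gamma>s)"
            using norm_Pair_le[of "\<theta>hat (t - 1) \<omega> - \<theta>s" "\<gamma> (t - 1) - \<gamma>s"] by (simp add: V_def dist_norm)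
          ultimately show False using \<omega>(2) by linarith
        qed
        then have "prob {\<omega> \<in> space M. dist (V t \<omega>) (\<theta>s, \<gamma>s) > \<epsilon>}
            \<le> prob (\<Union>a. {\<omega> \<in> space M. dist (\<theta>hat (t - 1) \<omega> $ a) (\<theta>s $ a) > \<delta>})"
          using meas by (intro finite_measure_mono sets.finite_UN) auto
        also have "\<dots> \<le> (\<Sum>a\<in>UNIV. prob {\<omega> \<in> space M. dist (\<theta>hat (t - 1) \<omega> $ a) (\<theta>s $ a) > \<delta>})"
          using meas by (intro finite_measure_subadditive_finite) auto
        finally show ?case by simp
      qed
    qed
  qed
  have V_hist: "V t \<in> borel_measurable (hist_sigma (t - 1))" for t
    unfolding V_def using \<theta>hat_hist by (intro borel_measurable_Pair) auto
  have V_meas: "V t \<in> borel_measurable M" for t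
    using measurable_from_subalg[OF subalgebra_hist V_hist] .
  show ?thesis
  proof
    fix a
    define F where "F x v = pol x (fst v) (snd v) $ a" for x v
    have F_meas: "case_prod F \<in> borel_measurable (ctx_space \<Otimes>\<^sub>M borel)"
      using measurable_compose[OF pol_measurable borel_measurable_vec_nth[of a]]
      by (simp add: F_def[abs_def] split_beta' borel_prod)
    have F_bound: "\<bar>F x v\<bar> \<le> 1" if "x \<in> space ctx_space" for x v
    proof -
      have "pol x (fst v) (snd v) \<in> prob_simplex"
        using pol_simplex that by (simp add: space_restrict_space)
      then show ?thesis
        using member_le_sum[of a UNIV "\<lambda>b. pol x (fst v) (snd v) $ b"] by (simp add: prob_simplex_def F_def)
    qed
    have F_cont: "AE x in distr M ctx_space (X 1). isCont (F x) (\<theta>s, \<gamma>s)"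
      \<comment> \<open>Time 1 represents all times, since the contexts share one law.\<close>
      using pol_cont[of 1, simplified]
    proof eventually_elim
      case (elim x)
      then show ?case
        unfolding F_def split_beta' by (rule isCont_o2[OF _ bounded_linear.isCont[OF bounded_linear_vec_nth continuous_ident]])
    qed
    have lim: "converges_in_prob M (\<lambda>t \<omega>. F (X t \<omega>) (V t \<omega>) - F (X t \<omega>) (\<theta>s, \<gamma>s)) (\<lambda>_. 0)"
    proof (rule converges_in_prob_compose_indep[OF X_ctx distr_X V_meas _ F_meas F_bound F_cont V_lim])
      show "distr M (ctx_space \<Otimes>\<^sub>M borel) (\<lambda>\<omega>. (X t \<omega>, V t \<omega>)) = distr M ctx_space (X t) \<Otimes>\<^sub>M distr M borel (V t)"
        if "t \<ge> 1" for t
        by (rule indep_rvs_distr_pair[OF indep_rvs_history[OF that] X_draw[OF that] V_hist])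
    qed
    show "converges_in_prob M (\<lambda>t \<omega>. P t \<omega> $ a - pol (X t \<omega>) \<theta>s \<gamma>s $ a) (\<lambda>_. 0)"
      unfolding converges_in_prob_def
    proof (intro allI impI)
      fix \<epsilon> :: real assume "\<epsilon> > 0"
      then have "(\<lambda>t. prob {\<omega> \<in> space M. norm (F (X t \<omega>) (V t \<omega>) - F (X t \<omega>) (\<theta>s, \<gamma>s) - 0) > \<epsilon>}) \<longlonglongrightarrow> 0"
        using lim by (simp add: converges_in_prob_def)
      then show "(\<lambda>t. prob {\<omega> \<in> space M. norm (P t \<omega> $ a - pol (X t \<omega>) \<theta>s \<gamma>s $ a - 0) > \<epsilon>}) \<longlonglongrightarrow> 0"
        \<comment> \<open>The two events coincide from time 1 on, where \<open>behavior\<close>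
          identifies \<open>P t \<omega>\<close> with the policy.\<close>
        by (rule Lim_transform_eventually, intro eventually_mono[OF eventually_ge_at_top[of 1]])
          (auto intro!: arg_cong[where f = prob] simp: behavior F_def V_def)
    qed
  qed
qed

end
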